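(* For every $k\ge2$, the following problem is undecidable: given a finite $k$-dimensional weighted game $G=(S_0,S_1,E)$, an initial state $s_{\mathrm{init}}\in S$, and a threshold $t\in\mathbb Q^k$, determine whether $P_0$ has a winning strategy from $s_{\mathrm{init}}$ for the objective $\mathrm{AEL}(t)=\{\pi\mid\forall n\ge1:\ \mathrm{EL}(\pi_{\le n})\ge 0\}\cap\{\pi\mid\overline{\mathrm{AE}}(\pi)\le t\}$.
   Context: A $k$-dimensional weighted game is $G=(S_0,S_1,E)$ with $S_0,S_1$ finite disjoint sets of states of players $P_0,P_1$, $S=S_0\cup S_1$, and $E\subseteq S\times[-W,W]^k\times S$ a finite set of edges weighted by integer vectors; every state has an outgoing edge. Plays (infinite edge sequences $e_1e_2\cdots$ with $\mathrm{tgt}(e_i)=\mathrm{src}(e_{i+1})$) and prefixes are as usual; $\pi_{\le n}$ is the prefix of the first $n$ edges. For a nonempty prefix $\rho=e_1\cdots e_n$, $\mathrm{EL}(\rho)=\sum_{i=1}^n w(e_i)\in\mathbb Z^k$ (initial energy zero) and $\mathrm{AE}(\rho)=\frac1n\sum_{i=1}^n\mathrm{EL}(e_1\cdots e_i)$; for a play $\pi$, $\overline{\mathrm{AE}}(\pi)$ is the componentwise $\limsup$ of $\mathrm{AE}(\pi_{\le n})$. All vector inequalities are componentwise. A strategy of $P_i$ maps every prefix ending in $S_i$ to an outgoing edge of its last state; a strategy of $P_0$ is winning if all its outcomes belong to the objective. *)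

theory Defs
  imports Complex_Main "HOL-Library.Extended_Real" "HOL-Library.Nat_Bijection"
begin

section \<open>Weighted games and the average-energy objective with lower bound\<close>

text \<open>An edge is a triple of source, integer weight vector and target; a vector of dimension
  \<open>k\<close> is a list of length \<open>k\<close>.\<close>

type_synonym 's edge = "'s \<times> int list \<times> 's"

definition src :: "'s edge \<Rightarrow> 's" where "src e = fst e"
definition wt :: "'s edge \<Rightarrow> int list" where "wt e = fst (snd e)"
definition tgt :: "'s edge \<Rightarrow> 's" where "tgt e = snd (snd e)"

record 's game =
  states0 :: "'s set"
  states1 :: "'s set"
  edges :: "'s edge set"

definition states :: "'s game \<Rightarrow> 's set" where
  "states G = states0 G \<union> states1 G"

text \<open>A bound \<open>W\<close> on the absolute values of the weights exists because \<open>edges G\<close> is finite.\<close>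

definition weighted_game :: "nat \<Rightarrow> 's game \<Rightarrow> bool" where
  "weighted_game k G \<longleftrightarrow>
     finite (states0 G) \<and> finite (states1 G) \<and> states0 G \<inter> states1 G = {} \<and>
     finite (edges G) \<and> edges G \<subseteq> states G \<times> {w. length w = k} \<times> states G \<and>
     (\<forall>s\<in>states G. \<exists>e\<in>edges G. src e = s)"

text \<open>Play positions start at 0: the value \<open>\<pi> i\<close> is the edge usually written \<open>e\<close> with index
  \<open>i + 1\<close>.\<close>

definition play_from :: "'s game \<Rightarrow> 's \<Rightarrow> (nat \<Rightarrow> 's edge) \<Rightarrow> bool" where
  "play_from G s \<pi> \<longleftrightarrow>
     src (\<pi> 0) = s \<and> (\<forall>i. \<pi> i \<in> edges G) \<and> (\<forall>i. tgt (\<pi> i) = src (\<pi> (Suc i)))"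

definition play_prefix :: "(nat \<Rightarrow> 's edge) \<Rightarrow> nat \<Rightarrow> 's edge list" where
  "play_prefix \<pi> n = map \<pi> [0..<n]"

text \<open>A prefix is given by its first state together with its list of edges, so that the empty
  prefix also has a last state.\<close>

fun prefix_from :: "'s game \<Rightarrow> 's \<Rightarrow> 's edge list \<Rightarrow> bool" where
  "prefix_from G s [] \<longleftrightarrow> s \<in> states G"
| "prefix_from G s (e # \<rho>) \<longleftrightarrow> e \<in> edges G \<and> src e = s \<and> prefix_from G (tgt e) \<rho>"

definition last_state :: "'s \<Rightarrow> 's edge list \<Rightarrow> 's" where
  "last_state s \<rho> = (if \<rho> = [] then s else tgt (last \<rho>))"

text \<open>Component \<open>j\<close> of the energy level (with initial energy zero) and of the average energy.\<close>

definition energy :: "'s edge list \<Rightarrow> nat \<Rightarrow> int" where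
  "energy \<rho> j = (\<Sum>e\<leftarrow>\<rho>. wt e ! j)"

definition avg_energy :: "'s edge list \<Rightarrow> nat \<Rightarrow> real" where
  "avg_energy \<rho> j = (\<Sum>i = 1..length \<rho>. real_of_int (energy (take i \<rho>) j)) / real (length \<rho>)"

definition sup_avg_energy :: "(nat \<Rightarrow> 's edge) \<Rightarrow> nat \<Rightarrow> ereal" where
  "sup_avg_energy \<pi> j = limsup (\<lambda>n. ereal (avg_energy (play_prefix \<pi> n) j))"

definition AEL :: "nat \<Rightarrow> rat list \<Rightarrow> (nat \<Rightarrow> 's edge) set" where
  "AEL k t =
     {\<pi>. \<forall>n\<ge>1. \<forall>j<k. 0 \<le> energy (play_prefix \<pi> n) j} \<inter>
     {\<pi>. \<forall>j<k. sup_avg_energy \<pi> j \<le> ereal (of_rat (t ! j))}"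

definition strategy0 :: "'s game \<Rightarrow> ('s \<Rightarrow> 's edge list \<Rightarrow> 's edge) \<Rightarrow> bool" where
  "strategy0 G \<sigma> \<longleftrightarrow>
     (\<forall>s \<rho>. prefix_from G s \<rho> \<and> last_state s \<rho> \<in> states0 G \<longrightarrow>
        \<sigma> s \<rho> \<in> edges G \<and> src (\<sigma> s \<rho>) = last_state s \<rho>)"

definition outcomes0 ::
  "'s game \<Rightarrow> ('s \<Rightarrow> 's edge list \<Rightarrow> 's edge) \<Rightarrow> 's \<Rightarrow> (nat \<Rightarrow> 's edge) set" where
  "outcomes0 G \<sigma> s =
     {\<pi>. play_from G s \<pi> \<and>
        (\<forall>n. last_state s (play_prefix \<pi> n) \<in> states0 G \<longrightarrow> \<pi> n = \<sigma> s (play_prefix \<pi> n))}"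

definition wins0 :: "'s game \<Rightarrow> 's \<Rightarrow> (nat \<Rightarrow> 's edge) set \<Rightarrow> bool" where
  "wins0 G s Obj \<longleftrightarrow> (\<exists>\<sigma>. strategy0 G \<sigma> \<and> outcomes0 G \<sigma> s \<subseteq> Obj)"

section \<open>Decidability\<close>

text \<open>Terms for partial recursive functions. Terms carry no arity; \<open>recf_eval f xs\<close> is the value
  of \<open>f\<close> on the argument list \<open>xs\<close>, and \<open>None\<close> if the computation diverges or \<open>xs\<close> has an
  unsuitable length. In \<open>PrimRec f g\<close> the recursion argument comes first, and the step function
  \<open>g\<close> receives the predecessor, the previous value and the parameters, in this order.\<close>

datatype recf =
    Zero
  | Succ
  | Proj nat
  | Comp recf "recf list"
  | PrimRec recf recf
  | Mu recf

fun recf_eval :: "recf \<Rightarrow> nat list \<Rightarrow> nat option" where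
  "recf_eval Zero xs = Some 0"
| "recf_eval Succ xs = (case xs of [x] \<Rightarrow> Some (Suc x) | _ \<Rightarrow> None)"
| "recf_eval (Proj i) xs = (if i < length xs then Some (xs ! i) else None)"
| "recf_eval (Comp f gs) xs =
     Option.bind (those (map (\<lambda>g. recf_eval g xs) gs)) (\<lambda>ys. recf_eval f ys)"
| "recf_eval (PrimRec f g) xs =
     (case xs of
        [] \<Rightarrow> None
      | n # ps \<Rightarrow>
          rec_nat (recf_eval f ps) (\<lambda>m r. Option.bind r (\<lambda>y. recf_eval g (m # y # ps))) n)"
| "recf_eval (Mu f) xs =
     (if \<exists>y. recf_eval f (y # xs) = Some 0 \<and> (\<forall>z<y. recf_eval f (z # xs) \<noteq> None)
      then Some (LEAST y. recf_eval f (y # xs) = Some 0)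
      else None)"

text \<open>A decision problem consists of a set \<open>I\<close> of instances, an encoding of instances as natural
  numbers and the set of instances with answer yes. A decision procedure has to halt with the right
  answer on every instance; nothing is required on numbers that encode no instance.\<close>

definition decidable :: "('a \<Rightarrow> nat) \<Rightarrow> 'a set \<Rightarrow> ('a \<Rightarrow> bool) \<Rightarrow> bool" where
  "decidable enc I P \<longleftrightarrow>
     (\<exists>f. \<forall>x\<in>I. recf_eval f [enc x] = Some (if P x then 1 else 0))"

section \<open>The decision problem\<close>

text \<open>States of input games are natural numbers. Finite sets are encoded by their canonical
  index (\<open>set_encode\<close>), rationals by their reduced fraction.\<close>

type_synonym AEL_input = "nat game \<times> nat \<times> rat list"

definition AEL_instances :: "nat \<Rightarrow> AEL_input set" where
  "AEL_instances k =
     {(G, s, t). weighted_game k G \<and> s \<in> states G \<and> length t = k}"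

fun AEL_wins :: "nat \<Rightarrow> AEL_input \<Rightarrow> bool" where
  "AEL_wins k (G, s, t) \<longleftrightarrow> wins0 G s (AEL k t)"

fun edge_encode :: "nat edge \<Rightarrow> nat" where
  "edge_encode (s, w, s') =
     prod_encode (s, prod_encode (list_encode (map int_encode w), s'))"

definition game_encode :: "nat game \<Rightarrow> nat" where
  "game_encode G =
     prod_encode (set_encode (states0 G),
       prod_encode (set_encode (states1 G), set_encode (edge_encode ` edges G)))"

definition rat_encode :: "rat \<Rightarrow> nat" where
  "rat_encode q = (case quotient_of q of (a, b) \<Rightarrow> prod_encode (int_encode a, int_encode b))"

fun instance_encode :: "AEL_input \<Rightarrow> nat" where
  "instance_encode (G, s, t) =
     prod_encode (game_encode G, prod_encode (s, list_encode (map rat_encode t)))"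

lemma inj_edge_encode: "inj edge_encode"
proof (rule injI)
  fix e e' :: "nat edge"
  assume "edge_encode e = edge_encode e'"
  then show "e = e'"
    by (cases e; cases e') (auto simp: list_encode_eq inj_map_eq_map[OF inj_int_encode])
qed

lemma inj_rat_encode: "inj rat_encode"
  by (rule injI, rule quotient_of_inject)
     (auto simp: rat_encode_def int_encode_eq split: prod.splits)

lemma instance_encode_inj: "inj_on instance_encode (AEL_instances k)"
proof (rule inj_onI)
  fix x y
  assume "x \<in> AEL_instances k" "y \<in> AEL_instances k"
    and eq: "instance_encode x = instance_encode y"
  then obtain G s t H u v where x: "x = (G, s, t)" "weighted_game k G"
    and y: "y = (H, u, v)" "weighted_game k H"
    by (auto simp: AEL_instances_def)
  have fin: "finite (states0 G)" "finite (states1 G)" "finite (edge_encode ` edges G)"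
    "finite (states0 H)" "finite (states1 H)" "finite (edge_encode ` edges H)"
    using x y by (auto simp: weighted_game_def)
  have "states0 G = states0 H" "states1 G = states1 H" "edge_encode ` edges G = edge_encode ` edges H"
    using eq fin by (auto simp: x y game_encode_def set_encode_eq)
  moreover from this have "edges G = edges H"
    using inj_edge_encode by (simp add: inj_image_eq_iff)
  ultimately have "G = H" by simp
  moreover have "s = u" "t = v"
    using eq by (auto simp: x y list_encode_eq inj_map_eq_map[OF inj_rat_encode])
  ultimately show "x = y" by (simp add: x y)
qed

end

theory Submission
  imports Defs "HOL-Library.Countable" "HOL-Library.Infinite_Set" "HOL-Library.Product_Plus"
    "HOL-Computational_Algebra.Primes"
begin

text \<open>A recursive function is compiled into a register program, and the contents \<open>s\<close> of the registers
  are coded as one number, the product of all \<open>p r ^ s r\<close> with distinct primes \<open>p r\<close>. This number is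
  the energy in one dimension, while the energy in the other dimension is zero. Player 0 simulates the
  program; multiplication and division by a prime move the code step by step to the other dimension.
  Zero tests are claims of player 0 that player 1 may challenge, and a challenge leads to a subgame
  that player 0 wins iff the claim is true, because there player 0 has to enter a sink (with a loop of
  weight zero) with energy exactly zero. As codes are positive, a faithful simulation never has energy
  zero, so with threshold 0 an infinite simulation is lost and player 0 wins iff the program halts.

  Undecidability follows by diagonalisation. The input of the program is the weight of the initial
  edge. Given the codes of the two state sets and of the remaining edges, a hypothetical decision
  procedure can be run on the game that simulates a program started on these very codes. A program
  that does so on the codes of its own game, and halts iff the answer is no, yields a contradiction.\<close>

subsection \<open>Register programs\<close>

text \<open>\<open>Loop r b\<close> decrements \<open>r\<close> before each round of
  \<open>b\<close> and ends when \<open>r\<close> is zero. There are no labels: the control state is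
  the list of commands still to be executed, which later becomes part of a game state.\<close>

datatype com = Inc nat | Loop nat "com list"

instance com :: countable by countable_datatype

inductive halts :: "com list \<Rightarrow> (nat \<Rightarrow> nat) \<Rightarrow> bool" where
  halts_Nil: "halts [] s"
| halts_Inc: "halts K (s(r := Suc (s r))) \<Longrightarrow> halts (Inc r # K) s"
| halts_Loop_zero: "s r = 0 \<Longrightarrow> halts K s \<Longrightarrow> halts (Loop r b # K) s"
| halts_Loop_pos: "s r > 0 \<Longrightarrow> halts (b @ Loop r b # K) (s(r := s r - 1)) \<Longrightarrow> halts (Loop r b # K) s"

inductive_simps halts_Inc_iff: "halts (Inc r # K) s"
inductive_simps halts_Loop_iff: "halts (Loop r b # K) s"

text \<open>The loop at its head with \<open>r\<close> positive and the loop inside its body lead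
  only to each other, so no derivation can end in the empty list.\<close>

lemma not_halts_diverge:
  assumes "s r > 0"
  shows "\<not> halts [Loop r [Inc r]] s"
proof -
  have "L = [Loop r [Inc r]] \<and> 0 < s r \<or> L = [Inc r, Loop r [Inc r]] \<Longrightarrow> False"
    if "halts L s" for L s
    using that by (induction rule: halts.induct) auto
  then show ?thesis using assms by blast
qed

text \<open>The equivalence under every continuation composes like a state transformation and also
  transports divergence; the diagonal argument uses both directions.\<close>

definition runs :: "com list \<Rightarrow> (nat \<Rightarrow> nat) \<Rightarrow> (nat \<Rightarrow> nat) \<Rightarrow> bool" where
  "runs P s s' \<longleftrightarrow> (\<forall>K. halts (P @ K) s \<longleftrightarrow> halts K s')"

lemma runs_Nil: "runs [] s s"
  by (simp add: runs_def)

lemma runs_append: "runs P s s' \<Longrightarrow> runs Q s' s'' \<Longrightarrow> runs (P @ Q) s s''"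
  by (simp add: runs_def)

lemma runs_Inc: "runs [Inc r] s (s(r := Suc (s r)))"
  by (simp add: runs_def halts_Inc_iff)

lemma runs_Loop_zero: "s r = 0 \<Longrightarrow> runs [Loop r b] s s"
  by (simp add: runs_def halts_Loop_iff)

lemma runs_Loop_pos:
  assumes "s r > 0" "runs b (s(r := s r - 1)) s'" "runs [Loop r b] s' s''"
  shows "runs [Loop r b] s s''"
  using assms by (simp add: runs_def halts_Loop_iff)

lemma runs_clear: "runs [Loop r []] s (s(r := 0))"
proof (induction "s r" arbitrary: s)
  case 0
  then have "s(r := 0) = s" by auto
  with 0 show ?case by (metis runs_Loop_zero)
next
  case (Suc n)
  have "runs [Loop r []] (s(r := s r - 1)) (s(r := 0))"
    using Suc(1)[of "s(r := s r - 1)"] Suc(2) by simp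
  then show ?case using Suc(2) by (auto intro: runs_Loop_pos[OF _ runs_Nil])
qed

lemma runs_move:
  assumes "i \<noteq> j"
  shows "runs [Loop i [Inc j]] s (s(i := 0, j := s j + s i))"
proof (induction "s i" arbitrary: s)
  case 0
  then have "s(i := 0, j := s j + s i) = s" by auto
  with 0 show ?case by (metis runs_Loop_zero)
next
  case (Suc n)
  let ?s = "s(i := s i - 1, j := Suc (s j))"
  have "runs [Loop i [Inc j]] ?s (?s(i := 0, j := ?s j + ?s i))"
    using Suc(1)[of ?s] Suc(2) assms by simp
  also have "?s(i := 0, j := ?s j + ?s i) = s(i := 0, j := s j + s i)"
    using assms Suc(2)[symmetric] by auto
  finally have *: "runs [Loop i [Inc j]] ?s (s(i := 0, j := s j + s i))" .
  have "runs [Inc j] (s(i := s i - 1)) ?s"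
    using runs_Inc[of j "s(i := s i - 1)"] assms by simp
  from runs_Loop_pos[OF _ this *] show ?case using Suc(2) by simp
qed

lemma runs_move2:
  assumes "i \<noteq> j" "i \<noteq> k" "j \<noteq> k"
  shows "runs [Loop i [Inc j, Inc k]] s (s(i := 0, j := s j + s i, k := s k + s i))"
proof (induction "s i" arbitrary: s)
  case 0
  then have "s(i := 0, j := s j + s i, k := s k + s i) = s" by auto
  with 0 show ?case by (metis runs_Loop_zero)
next
  case (Suc n)
  let ?s = "s(i := s i - 1, j := Suc (s j), k := Suc (s k))"
  have "runs [Loop i [Inc j, Inc k]] ?s (?s(i := 0, j := ?s j + ?s i, k := ?s k + ?s i))"
    using Suc(1)[of ?s] Suc(2) assms by simp
  also have "?s(i := 0, j := ?s j + ?s i, k := ?s k + ?s i) = s(i := 0, j := s j + s i, k := s k + s i)"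
    using assms Suc(2)[symmetric] by auto
  finally have *: "runs [Loop i [Inc j, Inc k]] ?s (s(i := 0, j := s j + s i, k := s k + s i))" .
  have "runs ([Inc j] @ [Inc k]) (s(i := s i - 1)) ?s"
    by (rule runs_append[OF runs_Inc]) (use runs_Inc[of k "s(i := s i - 1, j := Suc (s j))"] assms in simp)
  then have "runs [Inc j, Inc k] (s(i := s i - 1)) ?s" by simp
  from runs_Loop_pos[OF _ this *] show ?case using Suc(2) by simp
qed

text \<open>Reading a register by a loop destroys it, so the value is moved to the target and to the
  scratch register \<open>t\<close> at once and then restored from \<open>t\<close>.\<close>

definition copy :: "nat \<Rightarrow> nat \<Rightarrow> nat \<Rightarrow> com list" where
  "copy i j t = [Loop i [Inc j, Inc t]] @ [Loop t [Inc i]]"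

lemma runs_copy:
  assumes "i \<noteq> j" "i \<noteq> t" "j \<noteq> t" "s j = 0" "s t = 0"
  shows "runs (copy i j t) s (s(j := s i))"
proof -
  let ?s = "s(i := 0, j := s j + s i, t := s t + s i)"
  have "runs (copy i j t) s (?s(t := 0, i := ?s i + ?s t))"
    unfolding copy_def using assms by (intro runs_append[OF runs_move2 runs_move]) auto
  also have "?s(t := 0, i := ?s i + ?s t) = s(j := s i)"
    using assms by auto
  finally show ?thesis .
qed

section \<open>Compilation of recursive functions into register programs\<close>

text \<open>\<open>compile f args d c\<close> writes the value of \<open>f\<close> to register \<open>d\<close>; registers from \<open>c\<close> on are
  scratch space, assumed to be zero and restored to zero.\<close>

function compile :: "recf \<Rightarrow> nat list \<Rightarrow> nat \<Rightarrow> nat \<Rightarrow> com list" where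
  "compile Zero args d c = []"
| "compile Succ args d c = copy (hd args) d c @ [Inc d]"
| "compile (Proj i) args d c = copy (args ! i) d c"
| "compile (Comp f gs) args d c =
     concat (map (\<lambda>i. compile (gs ! i) args (c + i) (c + length gs)) [0..<length gs])
     @ compile f [c..<c + length gs] d (c + length gs)
     @ map (\<lambda>r. Loop r []) [c..<c + length gs]"
| "compile (PrimRec f g) args d c =
     copy (hd args) c (c + 1) @ compile f (tl args) d (c + 3)
     @ [Loop c (compile g ((c + 1) # d # tl args) (c + 2) (c + 3)
         @ [Loop d []] @ [Loop (c + 2) [Inc d]] @ [Inc (c + 1)])]
     @ [Loop (c + 1) []]"
| "compile (Mu f) args d c =
     compile f (d # args) c (c + 1)
     @ [Loop c ([Loop c []] @ [Inc d] @ compile f (d # args) c (c + 1))]"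
  by pat_completeness auto
termination
  by (relation "measure (\<lambda>(f, _). size f)")
    (auto simp: less_Suc_eq_le intro!: trans_le_add1 size_list_estimation'[OF nth_mem order_refl])

lemma runs_clear_upt: "runs (map (\<lambda>r. Loop r []) [c..<c + m]) s (\<lambda>r. if c \<le> r \<and> r < c + m then 0 else s r)"
proof (induction m)
  case 0
  have "(\<lambda>r. if c \<le> r \<and> r < c + 0 then 0 else s r) = s" by auto
  then show ?case by (metis add.right_neutral list.simps(8) runs_Nil upt_rec less_irrefl)
next
  case (Suc m)
  let ?s = "\<lambda>r. if c \<le> r \<and> r < c + m then 0 else s r"
  have "?s(c + m := 0) = (\<lambda>r. if c \<le> r \<and> r < c + Suc m then 0 else s r)"
    by auto
  with runs_append[OF Suc runs_clear[of "c + m" ?s]] show ?case by simp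
qed

lemma those_Some_iff: "those xs = Some ys \<longleftrightarrow> xs = map Some ys"
proof (induction xs arbitrary: ys)
  case Nil
  then show ?case by auto
next
  case (Cons x xs)
  then show ?case by (cases x; cases ys) auto
qed

text \<open>Only successful evaluations are considered, as the diagonal argument runs a computation
  known to be defined. The final store differs from the initial one in \<open>d\<close> alone, which
  lets the compiled pieces be chained.\<close>

lemma runs_compile:
  assumes "recf_eval f (map s args) = Some y"
    and "\<forall>r\<ge>c. s r = 0" "s d = 0" "d < c" "d \<notin> set args" "\<forall>r\<in>set args. r < c"
  shows "runs (compile f args d c) s (s(d := y))"
  using assms
proof (induction f args d c arbitrary: s y rule: compile.induct)
  case (1 args d c)
  then have "s(d := y) = s" by auto
  then show ?case by (simp add: runs_Nil)
next
  case (2 args d c)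
  then obtain x where x: "args = [x]" "y = Suc (s x)"
    by (auto split: list.splits)
  have "runs (copy x d c) s (s(d := s x))"
    using 2 x by (intro runs_copy) auto
  moreover have "runs [Inc d] (s(d := s x)) (s(d := y))"
    using runs_Inc[of d "s(d := s x)"] x by simp
  ultimately have "runs (copy x d c @ [Inc d]) s (s(d := y))" by (rule runs_append)
  then show ?case by (simp only: compile.simps x list.sel)
next
  case (3 i args d c)
  then have i: "i < length args" "y = s (args ! i)" by (auto split: if_splits)
  then have "args ! i \<in> set args" by simp
  then have "args ! i < c" "args ! i \<noteq> d" using 3 by auto
  then show ?case unfolding compile.simps i(2) using 3(2-5) by (intro runs_copy) auto
next
  case (4 f gs args d c)
  define m where "m = length gs"
  from 4(3) obtain ys where ys: "map (\<lambda>g. recf_eval g (map s args)) gs = map Some ys"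
    and y: "recf_eval f ys = Some y"
    by (auto simp: those_Some_iff split: Option.bind_splits)
  have len: "length ys = m" using ys by (metis length_map m_def)
  have ysn: "recf_eval (gs ! i) (map s args) = Some (ys ! i)" if "i < m" for i
    using ys that len by (metis length_map m_def nth_map)
  \<comment> \<open>\<open>T n\<close> is the store after the first \<open>n\<close> inner functions
    have left their values in the registers from \<open>c\<close> on.\<close>
  define T where "T n = (\<lambda>r. if c \<le> r \<and> r < c + n then ys ! (r - c) else s r)" for n
  define P where "P = (\<lambda>i. compile (gs ! i) args (c + i) (c + m))"
  have "runs (concat (map P [0..<n])) s (T n)" if "n \<le> m" for n
    using that
  proof (induction n)
    case 0
    have "T 0 = s" by (auto simp: T_def)
    then show ?case by (simp add: runs_Nil)
  next
    case (Suc n)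
    have "map (T n) args = map s args"
      using 4(8) by (auto simp: T_def)
    then have "recf_eval (gs ! n) (map (T n) args) = Some (ys ! n)"
      using ysn[of n] Suc.prems by (metis Suc_le_eq)
    moreover have "\<forall>r\<ge>c + m. T n r = 0" "T n (c + n) = 0"
      using 4(4) Suc.prems by (auto simp: T_def)
    ultimately have "runs (P n) (T n) ((T n)(c + n := ys ! n))"
      unfolding P_def m_def using Suc.prems 4(8)
      by (intro 4(1)) (auto simp: m_def)
    also have "(T n)(c + n := ys ! n) = T (Suc n)"
      by (auto simp: T_def)
    finally have "runs (P n) (T n) (T (Suc n))" .
    from runs_append[OF Suc.IH this] Suc.prems show ?case by simp
  qed
  then have 1: "runs (concat (map P [0..<m])) s (T m)" by simp
  have "map (T m) [c..<c + m] = ys"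
    by (rule nth_equalityI) (auto simp: T_def len)
  then have 2: "runs (compile f [c..<c + m] d (c + m)) (T m) ((T m)(d := y))"
    using 4(4-8) y unfolding m_def
    by (intro 4(2)) (auto simp: T_def m_def)
  have "(\<lambda>r. if c \<le> r \<and> r < c + m then 0 else ((T m)(d := y)) r) = s(d := y)"
    using 4(4-8) by (auto simp: T_def)
  with runs_clear_upt[of c m "(T m)(d := y)"]
  have 3: "runs (map (\<lambda>r. Loop r []) [c..<c + m]) ((T m)(d := y)) (s(d := y))"
    by simp
  with runs_append[OF 1 runs_append[OF 2 3]] show ?case
    by (simp only: compile.simps P_def flip: m_def)
next
  case (5 f g args d c)
  then obtain n ps where args: "args = n # ps" by (cases args) auto
  define R where "R = (\<lambda>i. rec_nat (recf_eval f (map s ps))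
     (\<lambda>m r. Option.bind r (\<lambda>y. recf_eval g (m # y # map s ps))) i)"
  have Rn: "R (s n) = Some y" using 5(3) by (simp add: args R_def)
  have R_Suc: "R (Suc i) = Option.bind (R i) (\<lambda>y. recf_eval g (i # y # map s ps))" for i
    by (simp add: R_def)
  \<comment> \<open>\<open>Option.bind\<close> is strict, so a defined value forces all earlier ones
    to be defined; hence the induction downwards from \<open>s n\<close>.\<close>
  have R_def_le: "i \<le> s n \<Longrightarrow> R i \<noteq> None" for i
  proof (induction rule: inc_induct)
    case base
    show ?case using Rn by simp
  next
    case (step i)
    then show ?case by (cases "R i") (auto simp: R_Suc)
  qed
  define v where "v i = the (R i)" for i
  have Rv: "R i = Some (v i)" if "i \<le> s n" for i
    using R_def_le[OF that] by (auto simp: v_def)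
  have bounds: "n < c" "n \<noteq> d" "d < c" "d \<notin> set ps" "\<forall>r\<in>set ps. r < c" "s d = 0" "\<forall>r\<ge>c. s r = 0"
    using 5(4-8) args by auto
  \<comment> \<open>The store after \<open>i\<close> rounds: \<open>c\<close> counts the rounds
    still to do, \<open>c + 1\<close> is the index passed to \<open>g\<close>, and \<open>d\<close>
    holds the current value. Within a round \<open>c + 2\<close> receives the next value.\<close>
  define T where "T i = s(c := s n - i, c + 1 := i, d := v i)" for i
  define body where "body = compile g ((c + 1) # d # ps) (c + 2) (c + 3)
         @ [Loop d []] @ [Loop (c + 2) [Inc d]] @ [Inc (c + 1)]"
  have 1: "runs (copy n c (c + 1)) s (s(c := s n))"
    using bounds by (intro runs_copy) auto
  have eq: "map (s(c := s n)) ps = map s ps"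
    using bounds by auto
  have "recf_eval f (map (s(c := s n)) (tl args)) = Some (v 0)"
    using Rv[of 0] unfolding args list.sel eq by (simp add: R_def)
  then have "runs (compile f (tl args) d (c + 3)) (s(c := s n)) ((s(c := s n))(d := v 0))"
    using bounds by (intro 5(1)) (assumption | auto simp: args)+
  then have "runs (compile f ps d (c + 3)) (s(c := s n)) ((s(c := s n))(d := v 0))"
    by (simp only: args list.sel)
  also have "(s(c := s n))(d := v 0) = T 0"
    using bounds by (auto simp: T_def)
  finally have 2: "runs (compile f ps d (c + 3)) (s(c := s n)) (T 0)" .
  have "runs [Loop c body] (T i) (T (s n))" if "i \<le> s n" for i
    using that
  proof (induction rule: inc_induct)
    case base
    show ?case using bounds by (intro runs_Loop_zero) (auto simp: T_def)
  next
    case (step i)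
    let ?t = "(T i)(c := T i c - 1)"
    have "recf_eval g (map ?t ((c + 1) # d # tl args)) = Some (v (Suc i))"
    proof -
      have "map ?t ((c + 1) # d # tl args) = i # v i # map s ps"
        using bounds by (auto simp: args T_def)
      then show ?thesis
        using Rv[of i] Rv[of "Suc i"] R_Suc[of i] step.hyps by simp
    qed
    then have "runs (compile g ((c + 1) # d # tl args) (c + 2) (c + 3)) ?t (?t(c + 2 := v (Suc i)))"
      using bounds by (intro 5(2)) (assumption | auto simp: args T_def)+
    then have a: "runs (compile g ((c + 1) # d # ps) (c + 2) (c + 3)) ?t (?t(c + 2 := v (Suc i)))"
      by (simp only: args list.sel)
    let ?t1 = "?t(c + 2 := v (Suc i))"
    have b: "runs [Loop d []] ?t1 (?t1(d := 0))" by (rule runs_clear)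
    let ?t2 = "?t1(d := 0)"
    have "c + 2 \<noteq> d" using bounds by simp
    note c = runs_move[OF this, of ?t2]
    note ab = runs_append[OF a runs_append[OF b runs_append[OF c runs_Inc[of "c + 1"]]]]
    let ?t3 = "?t2(c + 2 := 0, d := ?t2 d + ?t2 (c + 2))"
    have "?t3(c + 1 := Suc (?t3 (c + 1))) = T (Suc i)"
      using bounds step by (auto simp: T_def fun_eq_iff)
    then have "runs body ?t (T (Suc i))"
      using ab by (simp add: body_def)
    moreover have "T i c > 0" using bounds step by (auto simp: T_def)
    ultimately show ?case using step.IH by (metis runs_Loop_pos)
  qed
  then have 3: "runs [Loop c body] (T 0) (T (s n))" by simp
  have "(T (s n))(c + 1 := 0) = s(d := y)"
    using bounds Rn Rv[of "s n"] by (auto simp: T_def fun_eq_iff)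
  then have 4: "runs [Loop (c + 1) []] (T (s n)) (s(d := y))"
    using runs_clear[of "c + 1" "T (s n)"] by simp
  from runs_append[OF 1 runs_append[OF 2 runs_append[OF 3 4]]]
  show ?case by (simp only: compile.simps args body_def list.sel)
next
  case (6 f args d c)
  let ?ok = "\<lambda>y. recf_eval f (y # map s args) = Some 0 \<and> (\<forall>z<y. recf_eval f (z # map s args) \<noteq> None)"
  have ex: "\<exists>y. ?ok y" and y: "y = (LEAST y. recf_eval f (y # map s args) = Some 0)"
    using 6(3) by (auto split: if_splits)
  from ex obtain y0 where y0: "?ok y0" by blast
  have fy: "recf_eval f (y # map s args) = Some 0"
    unfolding y using y0 by (metis (mono_tags, lifting) LeastI)
  have lt: "recf_eval f (z # map s args) \<noteq> Some 0" if "z < y" for z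
    using that not_less_Least unfolding y by blast
  \<comment> \<open>All values up to some zero \<open>y0\<close> are defined, in particular those up
    to the least zero.\<close>
  have "y \<le> y0" using y0 unfolding y by (simp add: Least_le)
  then have nn: "recf_eval f (z # map s args) \<noteq> None" if "z \<le> y" for z
    using that y0 by (metis le_neq_implies_less le_trans option.simps(3))
  define v where "v z = the (recf_eval f (z # map s args))" for z
  have v: "recf_eval f (z # map s args) = Some (v z)" if "z \<le> y" for z
    using nn[OF that] by (auto simp: v_def)
  have v0: "v y = 0" using fy by (simp add: v_def)
  have vpos: "v z > 0" if "z < y" for z
    using lt[OF that] v[of z] that by auto
  have comp: "runs (compile f (d # args) c (c + 1)) (s(d := z)) (s(d := z, c := v z))" if "z \<le> y" for z
  proof -
    have "map (s(d := z)) (d # args) = z # map s args"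
      using 6(7) by auto
    then have "recf_eval f (map (s(d := z)) (d # args)) = Some (v z)"
      using v[OF that] by (simp only:)
    then show ?thesis using 6(4-8) by (intro 6(1)) (assumption | auto)+
  qed
  \<comment> \<open>\<open>d\<close> is at once the candidate, the first argument of
    \<open>f\<close> and the result, while \<open>c\<close> holds the value of \<open>f\<close>
    there. The loop test takes 1 from that value, and the body clears the rest.\<close>
  let ?body = "[Loop c []] @ [Inc d] @ compile f (d # args) c (c + 1)"
  have "runs [Loop c ?body] (s(d := z, c := v z)) (s(d := y))" if "z \<le> y" for z
    using that
  proof (induction rule: inc_induct)
    case base
    have "s(d := y, c := v y) = s(d := y)" using v0 6(4,6) by auto
    moreover have "(s(d := y)) c = 0" using 6(4,6) by auto
    ultimately show ?case by (metis runs_Loop_zero)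
  next
    case (step z)
    let ?t = "s(d := z, c := v z - 1)"
    have "d \<noteq> c" using 6(6) by simp
    have a: "runs [Loop c []] ?t (s(d := z))"
    proof -
      have "?t(c := 0) = s(d := z)" using 6(4,6) by auto
      then show ?thesis using runs_clear[of c ?t] by simp
    qed
    have b: "runs [Inc d] (s(d := z)) (s(d := Suc z))"
      using runs_Inc[of d "s(d := z)"] by simp
    have "runs ?body ?t (s(d := Suc z, c := v (Suc z)))"
      using step.hyps by (intro runs_append[OF a] runs_append[OF b] comp) simp
    then have c: "runs ?body ((s(d := z, c := v z))(c := (s(d := z, c := v z)) c - 1))
      (s(d := Suc z, c := v (Suc z)))" by simp
    have "0 < (s(d := z, c := v z)) c" using vpos[of z] step.hyps by simp
    from runs_Loop_pos[OF this c step.IH] show ?case .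
  qed
  from this[of 0] comp[of 0] have "runs (compile f (d # args) c (c + 1) @ [Loop c ?body]) (s(d := 0)) (s(d := y))"
    by (blast intro: runs_append le0)
  moreover have "s(d := 0) = s" using 6(5) by auto
  ultimately show ?case by (simp only: compile.simps)
qed

subsection \<open>Forcing energy zero and avoiding it\<close>

lemma energy_snoc: "energy (\<rho> @ [e]) j = energy \<rho> j + wt e ! j"
  by (simp add: energy_def)

lemma energy_Nil: "energy [] j = 0"
  by (simp add: energy_def)

lemma play_prefix_Suc: "play_prefix \<pi> (Suc n) = play_prefix \<pi> n @ [\<pi> n]"
  by (simp add: play_prefix_def)

lemma play_prefix_0: "play_prefix \<pi> 0 = []"
  by (simp add: play_prefix_def)

lemma last_state_snoc: "last_state s (\<rho> @ [e]) = tgt e"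
  by (simp add: last_state_def)

lemma last_state_play:
  "play_from G s \<pi> \<Longrightarrow> last_state s (play_prefix \<pi> n) = src (\<pi> n)"
  by (cases n) (auto simp: play_from_def play_prefix_Suc last_state_snoc play_prefix_0 last_state_def)

lemma avg_energy_play:
  "avg_energy (play_prefix \<pi> n) j = (\<Sum>i = 1..n. real_of_int (energy (play_prefix \<pi> i) j)) / real n"
proof -
  have "take i (play_prefix \<pi> n) = play_prefix \<pi> i" if "i \<le> n" for i
    using that by (simp add: play_prefix_def take_map)
  then show ?thesis
    unfolding avg_energy_def by (auto simp: play_prefix_def intro!: arg_cong2[where f = "(/)"] sum.cong)
qed

text \<open>From position \<open>n\<close> on the energies sum to a constant, so the averages are
  this constant divided by the length.\<close>

lemma sup_avg_energy_eventually_zero: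
  assumes "\<And>i. n \<le> i \<Longrightarrow> energy (play_prefix \<pi> i) j = 0"
  shows "sup_avg_energy \<pi> j = 0"
proof -
  define c where "c = (\<Sum>i = 1..n. real_of_int (energy (play_prefix \<pi> i) j))"
  have "avg_energy (play_prefix \<pi> m) j = c / real m" if "n \<le> m" for m
  proof -
    have "(\<Sum>i = 1..m. real_of_int (energy (play_prefix \<pi> i) j)) = c"
      unfolding c_def by (rule sum.mono_neutral_right) (use assms that in auto)
    then show ?thesis by (simp add: avg_energy_play)
  qed
  then have "eventually (\<lambda>m. c / real m = avg_energy (play_prefix \<pi> m) j) sequentially"
    unfolding eventually_sequentially by metis
  moreover have "(\<lambda>m. c / real m) \<longlonglongrightarrow> 0"
    by (rule lim_const_over_n)
  ultimately have "(\<lambda>m. avg_energy (play_prefix \<pi> m) j) \<longlonglongrightarrow> 0"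
    by (rule Lim_transform_eventually[rotated])
  then have "(\<lambda>m. ereal (avg_energy (play_prefix \<pi> m) j)) \<longlonglongrightarrow> 0"
    by (simp add: zero_ereal_def)
  then show ?thesis
    unfolding sup_avg_energy_def by (intro lim_imp_Limsup) auto
qed

section \<open>Attraction to energy zero and the resulting strategy of player 0\<close>

text \<open>In \<open>attracts G k z n s v\<close> the function \<open>v\<close> is the current energy, and player 0 can force,
  within \<open>n\<close> moves and without a negative energy, to be in state \<open>z\<close> with energy zero.\<close>

inductive attracts :: "'s game \<Rightarrow> nat \<Rightarrow> 's \<Rightarrow> nat \<Rightarrow> 's \<Rightarrow> (nat \<Rightarrow> int) \<Rightarrow> bool"
  for G k z where
  attracts_goal: "\<forall>j<k. v j = 0 \<Longrightarrow> attracts G k z n z v"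
| attracts_player0:
    "s \<in> states0 G \<Longrightarrow> e \<in> edges G \<Longrightarrow> src e = s \<Longrightarrow> \<forall>j<k. 0 \<le> v j + wt e ! j \<Longrightarrow>
     attracts G k z n (tgt e) (\<lambda>j. v j + wt e ! j) \<Longrightarrow> attracts G k z (Suc n) s v"
| attracts_player1:
    "s \<in> states1 G \<Longrightarrow>
     (\<And>e. e \<in> edges G \<Longrightarrow> src e = s \<Longrightarrow>
        (\<forall>j<k. 0 \<le> v j + wt e ! j) \<and> attracts G k z n (tgt e) (\<lambda>j. v j + wt e ! j)) \<Longrightarrow>
     attracts G k z (Suc n) s v"

lemma attracts_mono: "attracts G k z n s v \<Longrightarrow> n \<le> m \<Longrightarrow> attracts G k z m s v"
proof (induction arbitrary: m rule: attracts.induct)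
  case (attracts_goal v n)
  then show ?case by (simp add: attracts.attracts_goal)
next
  case (attracts_player0 s e v n)
  then show ?case
    by (cases m) (auto intro: attracts.attracts_player0)
next
  case (attracts_player1 s v n)
  then show ?case
    by (cases m) (auto intro!: attracts.attracts_player1)
qed

text \<open>One edge has to be good for all bounds at once, so that a strategy can pick it from
  state and energy without keeping track of a bound. At bound zero the truncated
  \<open>n - 1\<close> is zero again, which fits the loop at \<open>z\<close>.\<close>

definition progress :: "'s game \<Rightarrow> nat \<Rightarrow> 's \<Rightarrow> (nat \<Rightarrow> int) \<Rightarrow> 's edge \<Rightarrow> bool" where
  "progress G k z v e \<longleftrightarrow>
     (\<forall>n. attracts G k z n (src e) v \<longrightarrow>
        (\<forall>j<k. 0 \<le> v j + wt e ! j) \<and> attracts G k z (n - 1) (tgt e) (\<lambda>j. v j + wt e ! j))"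

lemma progress_goal:
  assumes "\<forall>e\<in>edges G. src e = z \<longrightarrow> tgt e = z \<and> (\<forall>j<k. wt e ! j = 0)"
    and "e \<in> edges G" "src e = z" "\<forall>j<k. v j = 0"
  shows "progress G k z v e"
  using assms
  by (auto simp: progress_def intro!: attracts.attracts_goal)

text \<open>The edge taken from a derivation with the least bound works for every larger bound by
  monotonicity. If there is no bound at all, the requirement is vacuous.\<close>

lemma progress_player0:
  assumes sink: "\<forall>e\<in>edges G. src e = z \<longrightarrow> tgt e = z \<and> (\<forall>j<k. wt e ! j = 0)"
    and "\<exists>e\<in>edges G. src e = s" "s \<notin> states1 G"
  shows "\<exists>e\<in>edges G. src e = s \<and> progress G k z v e"
proof (cases "\<exists>n. attracts G k z n s v")
  case False
  then show ?thesis using assms by (auto simp: progress_def)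
next
  case True
  define n where "n = (LEAST n. attracts G k z n s v)"
  have n: "attracts G k z n s v"
    unfolding n_def using True by (rule LeastI_ex)
  have least: "n \<le> m" if "attracts G k z m s v" for m
    using that unfolding n_def by (rule Least_le)
  from n show ?thesis
  proof cases
    case attracts_goal
    then show ?thesis using assms progress_goal[OF sink] by metis
  next
    case (attracts_player0 e n')
    have "progress G k z v e"
      unfolding progress_def
      using attracts_player0 least attracts_mono
      by (metis One_nat_def Suc_diff_1 Suc_le_mono diff_Suc_1 Suc_le_eq zero_less_Suc less_le_trans)
    then show ?thesis using attracts_player0 by blast
  next
    case attracts_player1
    then show ?thesis using assms by simp
  qed
qed

lemma progress_player1:
  assumes sink: "\<forall>e\<in>edges G. src e = z \<longrightarrow> tgt e = z \<and> (\<forall>j<k. wt e ! j = 0)"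
    and e: "e \<in> edges G" "src e \<notin> states0 G"
  shows "progress G k z v e"
  unfolding progress_def
proof (intro allI impI)
  fix n assume "attracts G k z n (src e) v"
  then show "(\<forall>j<k. 0 \<le> v j + wt e ! j) \<and> attracts G k z (n - 1) (tgt e) (\<lambda>j. v j + wt e ! j)"
  proof cases
    case attracts_goal
    then show ?thesis using sink e by (auto intro: attracts.attracts_goal)
  qed (use e in auto)
qed

lemma prefix_from_last: "weighted_game k G \<Longrightarrow> prefix_from G s \<rho> \<Longrightarrow> last_state s \<rho> \<in> states G"
proof (induction \<rho> arbitrary: s)
  case Nil
  then show ?case by (simp add: last_state_def)
next
  case (Cons e \<rho>)
  then show ?case by (cases "\<rho> = []") (auto simp: last_state_def)
qed

text \<open>Player 0 always follows some edge with \<open>progress\<close>. The bound drops in each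
  step until it is zero, and from then on the energy is zero forever.\<close>

lemma wins0_if_attracts:
  assumes G: "weighted_game k G"
    and sink: "\<forall>e\<in>edges G. src e = z \<longrightarrow> tgt e = z \<and> (\<forall>j<k. wt e ! j = 0)"
    and att: "attracts G k z n s (\<lambda>_. 0)"
  shows "wins0 G s (AEL k (replicate k 0))"
proof -
  define \<sigma> where "\<sigma> s \<rho> =
    (SOME e. e \<in> edges G \<and> src e = last_state s \<rho> \<and> progress G k z (energy \<rho>) e)" for s \<rho>
  have \<sigma>: "\<sigma> s \<rho> \<in> edges G \<and> src (\<sigma> s \<rho>) = last_state s \<rho> \<and> progress G k z (energy \<rho>) (\<sigma> s \<rho>)"
    if "last_state s \<rho> \<in> states0 G" for s \<rho>
  proof -
    have "\<exists>e\<in>edges G. src e = last_state s \<rho> \<and> progress G k z (energy \<rho>) e"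
      using G that by (intro progress_player0[OF sink]) (auto simp: weighted_game_def states_def)
    then show ?thesis
      unfolding \<sigma>_def by (intro someI_ex[where P = "\<lambda>e. e \<in> edges G \<and> src e = last_state s \<rho> \<and> progress G k z (energy \<rho>) e"]) blast
  qed
  have "\<pi> \<in> AEL k (replicate k 0)" if "\<pi> \<in> outcomes0 G \<sigma> s" for \<pi>
  proof -
    have play: "play_from G s \<pi>"
      and strat: "last_state s (play_prefix \<pi> i) \<in> states0 G \<Longrightarrow> \<pi> i = \<sigma> s (play_prefix \<pi> i)" for i
      using that by (auto simp: outcomes0_def)
    have edge: "\<pi> i \<in> edges G" for i using play by (simp add: play_from_def)
    have prog: "progress G k z (energy (play_prefix \<pi> i)) (\<pi> i)" for i
    proof (cases "src (\<pi> i) \<in> states0 G")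
      case True
      then show ?thesis using \<sigma>[of s "play_prefix \<pi> i"] strat[of i] last_state_play[OF play, of i] by metis
    next
      case False
      then show ?thesis by (rule progress_player1[OF sink edge])
    qed
    have inv: "attracts G k z (n - i) (src (\<pi> i)) (energy (play_prefix \<pi> i)) \<and>
        (\<forall>j<k. 0 \<le> energy (play_prefix \<pi> i) j)" for i
    proof (induction i)
      case 0
      have "energy [] = (\<lambda>_. 0)" by (auto simp: energy_Nil)
      show ?case using att play unfolding play_prefix_0 \<open>energy [] = (\<lambda>_. 0)\<close> by (simp add: play_from_def)
    next
      case (Suc i)
      have en: "energy (play_prefix \<pi> (Suc i)) = (\<lambda>j. energy (play_prefix \<pi> i) j + wt (\<pi> i) ! j)"
        by (auto simp: play_prefix_Suc energy_snoc)
      have "tgt (\<pi> i) = src (\<pi> (Suc i))" using play by (simp add: play_from_def)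
      with prog[of i] Suc show ?case unfolding progress_def en by fastforce
    qed
    \<comment> \<open>With bound zero only \<open>attracts_goal\<close> applies.\<close>
    have zero: "energy (play_prefix \<pi> i) j = 0" if "n \<le> i" "j < k" for i j
      using inv[of i] that by (auto elim: attracts.cases)
    have "sup_avg_energy \<pi> j = 0" if "j < k" for j
      using sup_avg_energy_eventually_zero[OF zero] that by blast
    then show ?thesis using inv by (simp add: AEL_def)
  qed
  moreover have "strategy0 G \<sigma>" using \<sigma> by (auto simp: strategy0_def)
  ultimately show ?thesis unfolding wins0_def by blast
qed

lemma sup_avg_energy_le_zero_D:
  assumes "sup_avg_energy \<pi> j \<le> 0" "0 < \<epsilon>"
  shows "eventually (\<lambda>n. avg_energy (play_prefix \<pi> n) j < \<epsilon>) sequentially"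
proof -
  have "sup_avg_energy \<pi> j < ereal \<epsilon>"
    using assms by (metis ereal_less(2) order_le_less_trans)
  then show ?thesis
    unfolding sup_avg_energy_def using Limsup_lessD by fastforce
qed

section \<open>Nonzero energies and traps for player 0\<close>

text \<open>Nonnegative integer energies that are not all zero sum up to at least 1, so the averages sum up
  to at least 1 as well.\<close>

lemma not_AEL_if_never_zero:
  assumes "\<And>i. 1 \<le> i \<Longrightarrow> \<exists>j<k. energy (play_prefix \<pi> i) j \<noteq> 0"
  shows "\<pi> \<notin> AEL k (replicate k 0)"
proof
  assume "\<pi> \<in> AEL k (replicate k 0)"
  then have nonneg: "1 \<le> n \<Longrightarrow> j < k \<Longrightarrow> 0 \<le> energy (play_prefix \<pi> n) j"
    and sup: "j < k \<Longrightarrow> sup_avg_energy \<pi> j \<le> 0" for n j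
    by (auto simp: AEL_def zero_ereal_def)
  have "k > 0" using assms[of 1] by auto
  \<comment> \<open>With \<open>1 / real k\<close> as bound in each dimension, the \<open>k\<close>
    averages sum to less than 1.\<close>
  have "eventually (\<lambda>n. \<forall>j\<in>{..<k}. avg_energy (play_prefix \<pi> n) j < 1 / real k) sequentially"
    using sup_avg_energy_le_zero_D[OF sup, of _ "1 / real k"] \<open>k > 0\<close>
    by (intro eventually_ball_finite) auto
  then have "eventually (\<lambda>n. (\<forall>j\<in>{..<k}. avg_energy (play_prefix \<pi> n) j < 1 / real k) \<and> 1 \<le> n) sequentially"
    using eventually_ge_at_top by (rule eventually_conj)
  then obtain n where n: "\<forall>j\<in>{..<k}. avg_energy (play_prefix \<pi> n) j < 1 / real k" "1 \<le> n"
    by (auto simp: eventually_sequentially)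
  have pos: "1 \<le> (\<Sum>j<k. real_of_int (energy (play_prefix \<pi> i) j))" if i: "1 \<le> i" for i
  proof -
    obtain j where j: "j < k" "energy (play_prefix \<pi> i) j \<noteq> 0" using assms[OF i] by blast
    then have "1 \<le> real_of_int (energy (play_prefix \<pi> i) j)"
      using nonneg[OF i j(1)] by linarith
    also have "\<dots> \<le> (\<Sum>j<k. real_of_int (energy (play_prefix \<pi> i) j))"
      using j nonneg[OF i] by (intro member_le_sum) auto
    finally show ?thesis .
  qed
  have "real n = (\<Sum>i = 1..n. 1)" by simp
  also have "\<dots> \<le> (\<Sum>i = 1..n. \<Sum>j<k. real_of_int (energy (play_prefix \<pi> i) j))"
    using pos by (intro sum_mono) auto
  also have "\<dots> = (\<Sum>j<k. avg_energy (play_prefix \<pi> n) j * real n)"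
    using n by (subst sum.swap) (simp add: avg_energy_play)
  also have "\<dots> < (\<Sum>j<k. 1 / real k * real n)"
    using n \<open>k > 0\<close> by (intro sum_strict_mono mult_strict_right_mono) auto
  also have "\<dots> = real n" using \<open>k > 0\<close> by simp
  finally show False by simp
qed

text \<open>\<open>B\<close> is an invariant that player 1 can keep and that player 0 can leave only
  by making an energy negative. It starts after the first edge because the initial energy is zero.
  Against any strategy of player 0 a play inside \<open>B\<close> is built, whose energy is never
  zero.\<close>

lemma not_wins0_if_trap:
  assumes G: "weighted_game k G" and "s0 \<in> states G"
    and init: "\<And>e. e \<in> edges G \<Longrightarrow> src e = s0 \<Longrightarrow> B (tgt e) (\<lambda>j. wt e ! j)"
    and nonzero: "\<And>s v. B s v \<Longrightarrow> \<exists>j<k. v j \<noteq> 0"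
    and player0: "\<And>s v e. B s v \<Longrightarrow> s \<in> states0 G \<Longrightarrow> e \<in> edges G \<Longrightarrow> src e = s \<Longrightarrow>
      \<forall>j<k. 0 \<le> v j + wt e ! j \<Longrightarrow> B (tgt e) (\<lambda>j. v j + wt e ! j)"
    and player1: "\<And>s v. B s v \<Longrightarrow> s \<in> states1 G \<Longrightarrow>
      \<exists>e\<in>edges G. src e = s \<and> B (tgt e) (\<lambda>j. v j + wt e ! j)"
  shows "\<not> wins0 G s0 (AEL k (replicate k 0))"
proof
  assume "wins0 G s0 (AEL k (replicate k 0))"
  then obtain \<sigma> where \<sigma>: "strategy0 G \<sigma>" and out: "outcomes0 G \<sigma> s0 \<subseteq> AEL k (replicate k 0)"
    by (auto simp: wins0_def)
  \<comment> \<open>Player 1 stays in \<open>B\<close> where possible and plays arbitrarily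
    elsewhere. Thus every prefix has a next edge, and the play can be defined by choice before
    \<open>B\<close> is known to hold along it.\<close>
  define good where "good \<rho> e \<longleftrightarrow> e \<in> edges G \<and> src e = last_state s0 \<rho> \<and>
      (last_state s0 \<rho> \<in> states0 G \<longrightarrow> e = \<sigma> s0 \<rho>) \<and>
      (B (last_state s0 \<rho>) (energy \<rho>) \<and> last_state s0 \<rho> \<in> states1 G \<longrightarrow>
         B (tgt e) (\<lambda>j. energy \<rho> j + wt e ! j))" for \<rho> e
  define next_edge where "next_edge \<rho> = (SOME e. good \<rho> e)" for \<rho>
  define H where "H n = rec_nat [] (\<lambda>_ \<rho>. \<rho> @ [next_edge \<rho>]) n" for n :: nat
  define \<pi> where "\<pi> n = next_edge (H n)" for n
  have H0: "H 0 = []" and HS: "H (Suc n) = H n @ [\<pi> n]" for n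
    by (auto simp: H_def \<pi>_def)
  have Hpre: "play_prefix \<pi> n = H n" for n
    by (induction n) (auto simp: H0 HS play_prefix_0 play_prefix_Suc)
  have prefix_snoc: "prefix_from G s (\<rho> @ [e])"
    if "prefix_from G s \<rho>" "e \<in> edges G" "src e = last_state s \<rho>" for s \<rho> e
    using that
  proof (induction \<rho> arbitrary: s)
    case Nil
    then show ?case using G by (auto simp: last_state_def weighted_game_def tgt_def)
  next
    case (Cons e' \<rho>)
    then show ?case by (auto simp: last_state_def split: if_splits)
  qed
  have ex: "good \<rho> (next_edge \<rho>)" if \<rho>: "prefix_from G s0 \<rho>" for \<rho>
  proof -
    let ?s = "last_state s0 \<rho>"
    have s: "?s \<in> states G" by (rule prefix_from_last[OF G \<rho>])
    have disj: "states0 G \<inter> states1 G = {}" using G by (simp add: weighted_game_def)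
    have "\<exists>e. good \<rho> e"
    proof (cases "?s \<in> states0 G")
      case True
      then have "good \<rho> (\<sigma> s0 \<rho>)" using \<sigma> \<rho> disj by (auto simp: good_def strategy0_def)
      then show ?thesis by blast
    next
      case False
      then have s1: "?s \<in> states1 G" using s by (simp add: states_def)
      show ?thesis
      proof (cases "B ?s (energy \<rho>)")
        case True
        then show ?thesis using player1[OF True s1] False unfolding good_def by blast
      next
        case nB: False
        then show ?thesis using G s False unfolding good_def weighted_game_def by blast
      qed
    qed
    then show ?thesis unfolding next_edge_def by (rule someI_ex)
  qed
  have pre: "prefix_from G s0 (H n)" for n
  proof (induction n)
    case 0
    then show ?case using assms by (simp add: H0)
  next
    case (Suc n)
    then show ?case using ex[OF Suc] unfolding HS \<pi>_def good_def by (intro prefix_snoc) auto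
  qed
  have good: "good (H n) (\<pi> n)" for n using ex[OF pre] by (simp add: \<pi>_def)
  have play: "play_from G s0 \<pi>"
    unfolding play_from_def
  proof (intro conjI allI)
    show "src (\<pi> 0) = s0" using good[of 0] by (simp add: good_def H0 last_state_def)
    show "\<pi> i \<in> edges G" for i using good[of i] by (simp add: good_def)
    show "tgt (\<pi> i) = src (\<pi> (Suc i))" for i
      using good[of "Suc i"] by (simp add: good_def HS last_state_snoc)
  qed
  then have "\<pi> \<in> outcomes0 G \<sigma> s0"
    using good by (auto simp: outcomes0_def Hpre good_def)
  with out have AEL: "\<pi> \<in> AEL k (replicate k 0)" by blast
  have "B (last_state s0 (H n)) (energy (H n))" if "1 \<le> n" for n
    using that
  proof (induction rule: dec_induct)
    case base
    have "B (tgt (\<pi> 0)) (\<lambda>j. wt (\<pi> 0) ! j)"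
      using play by (intro init) (auto simp: play_from_def)
    moreover have "energy [\<pi> 0] = (\<lambda>j. wt (\<pi> 0) ! j)" by (auto simp: energy_def)
    ultimately show ?case using HS[of 0] by (simp add: H0 last_state_def)
  next
    case (step n)
    let ?s = "last_state s0 (H n)"
    have en: "energy (H (Suc n)) = (\<lambda>j. energy (H n) j + wt (\<pi> n) ! j)"
      by (auto simp: HS energy_snoc)
    \<comment> \<open>The play is assumed to satisfy the objective, so the next edge makes no energy
      negative and \<open>player0\<close> applies.\<close>
    have "\<forall>j<k. 0 \<le> energy (H (Suc n)) j"
      using AEL by (auto simp: AEL_def simp flip: Hpre)
    then have nn: "\<forall>j<k. 0 \<le> energy (H n) j + wt (\<pi> n) ! j" by (simp add: en)
    have "?s \<in> states G" by (rule prefix_from_last[OF G pre])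
    then consider "?s \<in> states0 G" | "?s \<in> states1 G" by (auto simp: states_def)
    then have "B (tgt (\<pi> n)) (\<lambda>j. energy (H n) j + wt (\<pi> n) ! j)"
    proof cases
      case 1
      then show ?thesis using player0[OF step.IH 1 _ _ nn] good[of n] unfolding good_def by blast
    next
      case 2
      then show ?thesis using step.IH good[of n] unfolding good_def by blast
    qed
    then show ?case unfolding en by (simp add: HS last_state_snoc)
  qed
  then show False
    using not_AEL_if_never_zero[of k \<pi>] nonzero AEL unfolding Hpre by blast
qed

subsection \<open>The simulation game\<close>

definition nth_prime :: "nat \<Rightarrow> nat" where
  "nth_prime = enumerate {p. prime p}"

lemma prime_nth_prime: "prime (nth_prime r)"
  using enumerate_in_set[OF primes_infinite] by (simp add: nth_prime_def)

lemma nth_prime_eq_iff: "nth_prime r = nth_prime r' \<longleftrightarrow> r = r'"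
  using enumerate_mono_iff[OF primes_infinite] unfolding nth_prime_def
  by (metis linorder_neqE_nat less_irrefl)

lemma nth_prime_pos: "0 < nth_prime r"
  using prime_nth_prime prime_gt_0_nat by blast

text \<open>A program mentions finitely many registers, so those below a bound \<open>R\<close>
  suffice and the product is finite.\<close>

definition store_code :: "nat \<Rightarrow> (nat \<Rightarrow> nat) \<Rightarrow> nat" where
  "store_code R s = (\<Prod>r<R. nth_prime r ^ s r)"

lemma store_code_pos: "0 < store_code R s"
  by (simp add: store_code_def prod_pos nth_prime_pos)

lemma store_code_Suc:
  assumes "r < R"
  shows "store_code R (s(r := Suc (s r))) = nth_prime r * store_code R s"
proof -
  have "(\<Prod>r'\<in>{..<R} - {r}. nth_prime r' ^ (s(r := Suc (s r))) r') = (\<Prod>r'\<in>{..<R} - {r}. nth_prime r' ^ s r')"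
    by (rule prod.cong) auto
  then show ?thesis
    using assms by (simp add: store_code_def prod.remove[of "{..<R}" r])
qed

text \<open>A prime dividing the product divides one of the powers and hence equals its base, and
  distinct registers have distinct primes.\<close>

lemma dvd_store_code:
  assumes "r < R"
  shows "nth_prime r dvd store_code R s \<longleftrightarrow> 0 < s r"
proof
  assume "nth_prime r dvd store_code R s"
  then obtain r' where r': "nth_prime r dvd nth_prime r' ^ s r'"
    unfolding store_code_def
    by (auto simp: prime_dvd_prod_iff[OF finite_lessThan prime_nth_prime])
  then have "nth_prime r dvd nth_prime r'"
    by (rule prime_dvd_power[OF prime_nth_prime])
  then have "nth_prime r = nth_prime r'"
    by (rule primes_dvd_imp_eq[OF prime_nth_prime prime_nth_prime])
  then have "r' = r" by (simp add: nth_prime_eq_iff)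
  with r' show "0 < s r"
    using prime_gt_1_nat[OF prime_nth_prime[of r]] by (auto intro!: gr0I)
next
  assume "0 < s r"
  then have "nth_prime r dvd nth_prime r ^ s r" by simp
  also have "\<dots> dvd store_code R s"
    unfolding store_code_def using assms by (intro dvd_prodI) auto
  finally show "nth_prime r dvd store_code R s" .
qed

lemma store_code_dec:
  assumes "r < R" "0 < s r"
  shows "store_code R s = nth_prime r * store_code R (s(r := s r - 1))"
  using store_code_Suc[OF assms(1), of "s(r := s r - 1)"] assms(2) by simp

section \<open>The finite set of continuations\<close>

text \<open>The continuations that can occur in a run.\<close>

fun conts :: "com list \<Rightarrow> com list set" where
  "conts [] = {[]}"
| "conts (Inc r # K) = insert (Inc r # K) (conts K)"
| "conts (Loop r b # K) = insert (Loop r b # K) ((\<lambda>X. X @ Loop r b # K) ` conts b \<union> conts K)"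

lemma finite_conts: "finite (conts K)"
  by (induction K rule: conts.induct) auto

lemma conts_self: "K \<in> conts K"
  by (cases K rule: conts.cases) auto

lemma conts_Inc: "Inc r # K \<in> conts P \<Longrightarrow> K \<in> conts P"
proof (induction P arbitrary: r K rule: conts.induct)
  case (2 r' K')
  then show ?case using conts_self by auto
next
  case (3 r' b K')
  from "3.prems" consider X where "Inc r # K = X @ Loop r' b # K'" "X \<in> conts b" | "Inc r # K \<in> conts K'"
    by auto
  then show ?case
  proof cases
    case 1
    then obtain Y where "X = Inc r # Y" "K = Y @ Loop r' b # K'" by (cases X) auto
    then show ?thesis using 3(1) 1 by auto
  next
    case 2
    then show ?thesis using 3(2) by auto
  qed
qed simp

text \<open>Together with \<open>conts_Inc\<close> this closes \<open>conts P\<close> under the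
  steps of a run, which keeps the game finite. A loop nested in the body of another one is handled
  within that body, and the outer loop is then appended.\<close>

lemma conts_Loop: "Loop r c # K \<in> conts P \<Longrightarrow> K \<in> conts P \<and> c @ Loop r c # K \<in> conts P"
proof (induction P arbitrary: r c K rule: conts.induct)
  case (2 r' K')
  then show ?case by auto
next
  case (3 r' b K')
  from "3.prems" consider "Loop r c # K = Loop r' b # K'"
    | X where "Loop r c # K = X @ Loop r' b # K'" "X \<in> conts b" "X \<noteq> []" | "Loop r c # K \<in> conts K'"
    by fastforce
  then show ?case
  proof cases
    case 1
    then show ?thesis using conts_self by auto
  next
    case 2
    then obtain Y where Y: "X = Loop r c # Y" "K = Y @ Loop r' b # K'" by (cases X) auto
    then have "Y \<in> conts b" "c @ Loop r c # Y \<in> conts b" using 3(1) 2 by auto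
    moreover have "c @ Loop r c # K = (c @ Loop r c # Y) @ Loop r' b # K'" by (simp add: Y)
    ultimately show ?thesis by (auto simp: Y(2) simp del: append_assoc)
  next
    case 3
    then show ?thesis using "3.IH"(2) by auto
  qed
qed simp

section \<open>States and edges of the game\<close>

text \<open>In state \<open>Main d K\<close> the store is coded in dimension 0 if \<open>d\<close> holds and in dimension 1
  otherwise, and the other energy is zero. Multiplications and divisions by a prime move the code to
  the other dimension (\<open>Mul\<close>). Player 1 may doubt that the old dimension has been emptied (\<open>Check\<close>)
  and that a register is zero (\<open>Zero_test\<close>), and player 0 refutes the doubt by reaching energy zero
  in the state \<open>Sink\<close>.\<close>

datatype st = Init | Start | Sink
  | Main bool "com list"
  | Mul bool bool nat "com list"
  | Check bool "com list"
  | Drain bool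
  | Zero_test bool nat "com list"
  | Nondiv bool nat
  | Div bool nat

instance st :: countable by countable_datatype

fun owned1 :: "st \<Rightarrow> bool" where
  "owned1 (Check d K) = True"
| "owned1 (Zero_test d r K) = True"
| "owned1 _ = False"

definition orient :: "bool \<Rightarrow> int \<Rightarrow> int \<Rightarrow> int \<times> int" where
  "orient d u v = (if d then (u, v) else (v, u))"

text \<open>The flag \<open>m\<close> selects multiplication or division. Each transfer takes
  \<open>divisor m r\<close> from the old dimension and puts \<open>factor m r\<close> into the new
  one.\<close>

definition factor :: "bool \<Rightarrow> nat \<Rightarrow> nat" where
  "factor m r = (if m then nth_prime r else 1)"

definition divisor :: "bool \<Rightarrow> nat \<Rightarrow> nat" where
  "divisor m r = (if m then 1 else nth_prime r)"

text \<open>\<open>Drain d\<close> lowers only the dimension not selected by \<open>d\<close>, so it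
  can reach energy zero only if the selected one is empty. \<open>Nondiv\<close> removes a nonzero
  remainder and \<open>Div\<close> multiples of the prime, which cannot end at zero on a divisible
  code. Entering a loop body wrongly has no test of its own: the division leaves a remainder, which
  \<open>Check\<close> exposes.\<close>

fun succs :: "nat \<Rightarrow> com list \<Rightarrow> st \<Rightarrow> ((int \<times> int) \<times> st) set" where
  "succs n P Init = {((int n, 0), Start)}"
| "succs n P Start = {((0, 0), Main True P)}"
| "succs n P Sink = {((0, 0), Sink)}"
| "succs n P (Main d []) = {((0, 0), Drain (\<not> d))}"
| "succs n P (Main d (Inc r # K)) = {((0, 0), Mul d True r K)}"
| "succs n P (Main d (Loop r b # K)) =
     {((0, 0), Zero_test d r K), ((0, 0), Mul d False r (b @ Loop r b # K))}"
| "succs n P (Mul d m r K) =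
     {(orient d (- int (divisor m r)) (int (factor m r)), Mul d m r K),
      ((0, 0), Check d K)}"
| "succs n P (Check d K) = {((0, 0), Main (\<not> d) K), ((0, 0), Drain d)}"
| "succs n P (Drain d) = {(orient d 0 (-1), Drain d), ((0, 0), Sink)}"
| "succs n P (Zero_test d r K) = {((0, 0), Main d K), ((0, 0), Nondiv d r)}"
| "succs n P (Nondiv d r) = (\<lambda>i. (orient d (- int i) 0, Div d r)) ` {1..<nth_prime r}"
| "succs n P (Div d r) = {(orient d (- int (nth_prime r)) 0, Div d r), ((0, 0), Sink)}"

definition regs :: "com list \<Rightarrow> nat set" where
  "regs P = {r. \<exists>K. Inc r # K \<in> conts P} \<union> {r. \<exists>b K. Loop r b # K \<in> conts P}"

lemma finite_regs: "finite (regs P)"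
proof -
  have "regs P \<subseteq> (\<lambda>K. case hd K of Inc r \<Rightarrow> r | Loop r b \<Rightarrow> r) ` conts P"
    by (force simp: regs_def)
  then show ?thesis using finite_conts finite_surj by blast
qed

lemma regs_Inc: "Inc r # K \<in> conts P \<Longrightarrow> r \<in> regs P"
  and regs_Loop: "Loop r b # K \<in> conts P \<Longrightarrow> r \<in> regs P"
  by (auto simp: regs_def)

fun valid :: "com list \<Rightarrow> st \<Rightarrow> bool" where
  "valid P (Main d K) \<longleftrightarrow> K \<in> conts P"
| "valid P (Check d K) \<longleftrightarrow> K \<in> conts P"
| "valid P (Mul d m r K) \<longleftrightarrow> r \<in> regs P \<and> K \<in> conts P"
| "valid P (Zero_test d r K) \<longleftrightarrow> r \<in> regs P \<and> K \<in> conts P"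
| "valid P (Nondiv d r) \<longleftrightarrow> r \<in> regs P"
| "valid P (Div d r) \<longleftrightarrow> r \<in> regs P"
| "valid P _ \<longleftrightarrow> True"

definition game_states :: "com list \<Rightarrow> st set" where
  "game_states P = {q. valid P q}"

lemma finite_game_states: "finite (game_states P)"
proof (rule finite_subset)
  let ?C = "conts P" and ?R = "regs P"
  show "game_states P \<subseteq> {Init, Start, Sink} \<union> range Drain
     \<union> (\<lambda>(d, K). Main d K) ` (UNIV \<times> ?C) \<union> (\<lambda>(d, K). Check d K) ` (UNIV \<times> ?C)
     \<union> (\<lambda>(d, m, r, K). Mul d m r K) ` (UNIV \<times> UNIV \<times> ?R \<times> ?C)
     \<union> (\<lambda>(d, r, K). Zero_test d r K) ` (UNIV \<times> ?R \<times> ?C)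
     \<union> (\<lambda>(d, r). Nondiv d r) ` (UNIV \<times> ?R) \<union> (\<lambda>(d, r). Div d r) ` (UNIV \<times> ?R)" (is "_ \<subseteq> ?S")
  proof
    fix q assume "q \<in> game_states P"
    then show "q \<in> ?S" by (cases q) (auto simp: game_states_def image_iff)
  qed
  show "finite ?S" using finite_conts finite_regs by (intro finite_UnI finite_imageI finite_cartesian_product) auto
qed

lemma finite_succs: "finite (succs n P q)"
  by (cases "(n, P, q)" rule: succs.cases) auto

lemma succs_nonempty: "succs n P q \<noteq> {}"
  by (cases "(n, P, q)" rule: succs.cases) (use prime_gt_1_nat[OF prime_nth_prime] in auto)

lemma succs_closed: "q \<in> game_states P \<Longrightarrow> (w, q') \<in> succs n P q \<Longrightarrow> q' \<in> game_states P"
  by (cases "(n, P, q)" rule: succs.cases)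
    (auto simp: game_states_def conts_self dest: conts_Inc conts_Loop regs_Inc regs_Loop)

text \<open>All dimensions beyond the first two have weight zero, so two dimensions carry the
  argument for every \<open>k\<close>.\<close>

definition mk_edge :: "nat \<Rightarrow> st \<Rightarrow> (int \<times> int) \<times> st \<Rightarrow> nat edge" where
  "mk_edge k q e = (to_nat q, fst (fst e) # snd (fst e) # replicate (k - 2) 0, to_nat (snd e))"

definition sim_game :: "nat \<Rightarrow> nat \<Rightarrow> com list \<Rightarrow> nat game" where
  "sim_game k n P =
     \<lparr>states0 = to_nat ` {q \<in> game_states P. \<not> owned1 q},
      states1 = to_nat ` {q \<in> game_states P. owned1 q},
      edges = (\<Union>q\<in>game_states P. mk_edge k q ` succs n P q)\<rparr>"

lemma states_sim_game: "states (sim_game k n P) = to_nat ` game_states P"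
  by (auto simp: states_def sim_game_def)

lemma edge_sim_gameE:
  assumes "e \<in> edges (sim_game k n P)" "src e = to_nat q"
  obtains u v q' where "q \<in> game_states P" "((u, v), q') \<in> succs n P q" "e = mk_edge k q ((u, v), q')"
  using assms by (auto simp: sim_game_def mk_edge_def src_def)

lemma edge_sim_gameI:
  "q \<in> game_states P \<Longrightarrow> x \<in> succs n P q \<Longrightarrow> mk_edge k q x \<in> edges (sim_game k n P)"
  by (auto simp: sim_game_def)

lemma mk_edge_simps:
  "src (mk_edge k q ((u, v), q')) = to_nat q"
  "tgt (mk_edge k q ((u, v), q')) = to_nat q'"
  "wt (mk_edge k q ((u, v), q')) = u # v # replicate (k - 2) 0"
  by (auto simp: mk_edge_def src_def tgt_def wt_def)

lemma weighted_game_sim_game: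
  assumes "2 \<le> k"
  shows "weighted_game k (sim_game k n P)"
  unfolding weighted_game_def states_sim_game
proof (intro conjI ballI)
  fix s assume "s \<in> to_nat ` game_states P"
  then obtain q where q: "s = to_nat q" "q \<in> game_states P" by auto
  obtain u v q' where "((u, v), q') \<in> succs n P q" using succs_nonempty by fast
  then show "\<exists>e\<in>edges (sim_game k n P). src e = s"
    using q edge_sim_gameI mk_edge_simps(1) by metis
next
  show "edges (sim_game k n P) \<subseteq> to_nat ` game_states P \<times> {w. length w = k} \<times> to_nat ` game_states P"
    using assms succs_closed by (fastforce simp: sim_game_def mk_edge_def)
next
  show "states0 (sim_game k n P) \<inter> states1 (sim_game k n P) = {}"
    by (auto simp: sim_game_def dest: injD[OF inj_to_nat])
qed (auto simp: sim_game_def finite_game_states finite_succs)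

section \<open>Energy vectors as pairs\<close>

lemma orient_add: "orient d x y + orient d u v = orient d (x + u) (y + v)"
  by (simp add: orient_def)

lemma orient_zero: "orient d 0 0 = (0, 0)"
  by (simp add: orient_def)

lemma orient_not: "orient (\<not> d) x y = orient d y x"
  by (simp add: orient_def)

lemma orient_nonneg: "0 \<le> fst (orient d x y) \<and> 0 \<le> snd (orient d x y) \<longleftrightarrow> 0 \<le> x \<and> 0 \<le> y"
  by (auto simp: orient_def)

lemma orient_nonnegD: "0 \<le> fst (orient d x y) \<Longrightarrow> 0 \<le> snd (orient d x y) \<Longrightarrow> 0 \<le> x \<and> 0 \<le> y"
  using orient_nonneg by blast

lemma add_zero_pair: "z + (0 :: int, 0 :: int) = z"
  by (cases z) simp

text \<open>Components from \<open>k\<close> on stay unconstrained, because \<open>wt e ! j\<close>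
  is unspecified there.\<close>

definition represents :: "nat \<Rightarrow> (nat \<Rightarrow> int) \<Rightarrow> int \<times> int \<Rightarrow> bool" where
  "represents k v z \<longleftrightarrow> v 0 = fst z \<and> v 1 = snd z \<and> (\<forall>j. 2 \<le> j \<and> j < k \<longrightarrow> v j = 0)"

lemma represents_iff:
  assumes "represents k v z" "2 \<le> k"
  shows "(\<forall>j<k. Q (v j)) \<longleftrightarrow> Q (fst z) \<and> Q (snd z) \<and> (2 < k \<longrightarrow> Q 0)"
proof (intro iffI conjI impI allI)
  assume *: "\<forall>j<k. Q (v j)"
  have "v 0 = fst z" "v 1 = snd z" using assms by (auto simp: represents_def)
  moreover have "0 < k" "1 < k" using assms by auto
  ultimately show "Q (fst z)" "Q (snd z)" using * by metis+
  assume "2 < k"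
  then have "v 2 = 0" using assms by (auto simp: represents_def)
  then show "Q 0" using * \<open>2 < k\<close> by metis
next
  fix j assume *: "Q (fst z) \<and> Q (snd z) \<and> (2 < k \<longrightarrow> Q 0)" and "j < k"
  consider "j = 0" | "j = 1" | "2 \<le> j" by linarith
  then show "Q (v j)"
  proof cases
    case 3
    then have "v j = 0" using assms \<open>j < k\<close> by (auto simp: represents_def)
    then show ?thesis using * 3 \<open>j < k\<close> by simp
  qed (use * assms(1) in \<open>auto simp: represents_def\<close>)
qed

lemma represents_step:
  assumes "represents k v z" "2 \<le> k"
  shows "represents k (\<lambda>j. v j + wt (mk_edge k q (w, q')) ! j) (z + w)"
proof -
  let ?W = "wt (mk_edge k q (w, q'))"
  have "?W ! j = 0" if j: "2 \<le> j" "j < k" for j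
  proof -
    obtain i where "j = 2 + i" using le_Suc_ex[OF j(1)] ..
    then show ?thesis using j by (simp add: mk_edge_def wt_def)
  qed
  moreover have "?W ! 0 = fst w" "?W ! 1 = snd w" by (simp_all add: mk_edge_def wt_def)
  ultimately show ?thesis
    using assms by (simp add: represents_def)
qed

section \<open>Player 0 wins the simulation of a halting program\<close>

locale simulation =
  fixes k n :: nat and P :: "com list"
  assumes k: "2 \<le> k"
begin

abbreviation G :: "nat game" where "G \<equiv> sim_game k n P"

text \<open>The bound is chosen before \<open>v\<close>, so it depends only on the state and the
  pair, and at a state of player 1 the maximum over the finitely many edges serves as common
  bound.\<close>

definition reach :: "st \<Rightarrow> int \<times> int \<Rightarrow> bool" where
  "reach q z \<longleftrightarrow> (\<exists>m. \<forall>v. represents k v z \<longrightarrow> attracts G k (to_nat Sink) m (to_nat q) v)"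

lemma reach_goal: "reach Sink (0, 0)"
proof -
  have "\<forall>j<k. v j = 0" if "represents k v (0, 0)" for v
    using represents_iff[OF that k, of "\<lambda>x. x = 0"] by simp
  then show ?thesis
    by (auto simp: reach_def intro!: attracts.attracts_goal)
qed

lemma reach_player0:
  assumes "q \<in> game_states P" "\<not> owned1 q" "(w, q') \<in> succs n P q"
    and "0 \<le> fst (z + w)" "0 \<le> snd (z + w)" "reach q' (z + w)"
  shows "reach q z"
proof -
  from assms(6) obtain m where m: "\<And>v. represents k v (z + w) \<Longrightarrow> attracts G k (to_nat Sink) m (to_nat q') v"
    unfolding reach_def by blast
  have "attracts G k (to_nat Sink) (Suc m) (to_nat q) v" if "represents k v z" for v
  proof (rule attracts.attracts_player0)
    let ?e = "mk_edge k q (w, q')"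
    show "to_nat q \<in> states0 G" using assms(1,2) by (auto simp: sim_game_def)
    show "?e \<in> edges G" using assms(1,3) by (rule edge_sim_gameI)
    show "src ?e = to_nat q" by (simp add: mk_edge_def src_def)
    have r: "represents k (\<lambda>j. v j + wt ?e ! j) (z + w)" by (rule represents_step[OF that k])
    show "\<forall>j<k. 0 \<le> v j + wt ?e ! j"
      using represents_iff[OF r k, of "\<lambda>x. 0 \<le> x"] assms(4,5) by simp
    show "attracts G k (to_nat Sink) m (tgt ?e) (\<lambda>j. v j + wt ?e ! j)"
      using m[OF r] by (simp add: mk_edge_def tgt_def)
  qed
  then show ?thesis unfolding reach_def by blast
qed

lemma reach_player1:
  assumes "q \<in> game_states P" "owned1 q"
    and step: "\<And>w q'. (w, q') \<in> succs n P q \<Longrightarrow> 0 \<le> fst (z + w) \<and> 0 \<le> snd (z + w) \<and> reach q' (z + w)"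
  shows "reach q z"
proof -
  define Q :: "(int \<times> int) \<times> st \<Rightarrow> nat \<Rightarrow> bool" where "Q x m \<longleftrightarrow> (\<forall>v. represents k v (z + fst x) \<longrightarrow>
      attracts G k (to_nat Sink) m (to_nat (snd x)) v)" for x m
  have "\<exists>m. Q x m" if "x \<in> succs n P q" for x
    using that step[of "fst x" "snd x"] unfolding Q_def reach_def by simp
  then obtain f where f: "\<And>x. x \<in> succs n P q \<Longrightarrow> Q x (f x)" by metis
  define m where "m = Max (f ` succs n P q)"
  have m: "Q x m" if "x \<in> succs n P q" for x
  proof -
    have "f x \<le> m" unfolding m_def using that finite_succs by (intro Max_ge) auto
    from f[OF that] show ?thesis
      unfolding Q_def by (auto intro: attracts_mono[OF _ \<open>f x \<le> m\<close>])
  qed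
  have "attracts G k (to_nat Sink) (Suc m) (to_nat q) v" if "represents k v z" for v
  proof (rule attracts.attracts_player1)
    show "to_nat q \<in> states1 G" using assms(1,2) by (auto simp: sim_game_def)
    fix e assume "e \<in> edges G" "src e = to_nat q"
    then obtain u t q' where e: "((u, t), q') \<in> succs n P q" "e = mk_edge k q ((u, t), q')"
      by (rule edge_sim_gameE)
    have r: "represents k (\<lambda>j. v j + wt e ! j) (z + (u, t))"
      unfolding e by (rule represents_step[OF that k])
    have "\<forall>j<k. 0 \<le> v j + wt e ! j"
      using represents_iff[OF r k, of "\<lambda>x. 0 \<le> x"] step[OF e(1)] by simp
    moreover have "attracts G k (to_nat Sink) m (tgt e) (\<lambda>j. v j + wt e ! j)"
      using m[OF e(1)] r by (simp add: Q_def e(2) mk_edge_simps(2))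
    ultimately show "(\<forall>j<k. 0 \<le> v j + wt e ! j) \<and>
        attracts G k (to_nat Sink) m (tgt e) (\<lambda>j. v j + wt e ! j)" by blast
  qed
  then show ?thesis unfolding reach_def by blast
qed

lemma reach_move:
  assumes "q \<in> game_states P" "\<not> owned1 q" "(orient d u t, q') \<in> succs n P q"
    and "0 \<le> x + u" "0 \<le> y + t" "reach q' (orient d (x + u) (y + t))"
  shows "reach q (orient d x y)"
  using assms orient_nonneg[of d "x + u" "y + t"] by - (rule reach_player0[where w = "orient d u t" and q' = q']; auto simp: orient_add)

lemma reach_stay:
  assumes "q \<in> game_states P" "\<not> owned1 q" "((0, 0), q') \<in> succs n P q"
    and "0 \<le> x" "0 \<le> y" "reach q' (orient d x y)"
  shows "reach q (orient d x y)"
  using assms by - (rule reach_move[where u = 0 and t = 0]; auto simp: orient_zero)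

lemma reach_Drain: "reach (Drain d) (orient d 0 (int y))"
proof (induction y)
  case 0
  then show ?case
    using reach_goal by - (rule reach_stay[where q' = Sink]; auto simp: game_states_def orient_zero)
next
  case (Suc y)
  then show ?case
    by - (rule reach_move[where q' = "Drain d" and u = 0 and t = "-1"]; auto simp: game_states_def)
qed

lemma reach_Div:
  assumes "r \<in> regs P"
  shows "reach (Div d r) (orient d (int (nth_prime r * m)) 0)"
proof (induction m)
  case 0
  then show ?case
    using reach_goal assms by - (rule reach_stay[where q' = Sink]; auto simp: game_states_def orient_zero)
next
  case (Suc m)
  then show ?case using assms
    by - (rule reach_move[where q' = "Div d r" and u = "- int (nth_prime r)" and t = 0]; auto simp: game_states_def algebra_simps)
qed

lemma reach_Nondiv:
  assumes "r \<in> regs P" "\<not> nth_prime r dvd x"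
  shows "reach (Nondiv d r) (orient d (int x) 0)"
proof (rule reach_move)
  let ?p = "nth_prime r"
  show "Nondiv d r \<in> game_states P" "\<not> owned1 (Nondiv d r)" using assms by (auto simp: game_states_def)
  \<comment> \<open>The remainder is the amount to subtract; it is nonzero because the prime does
    not divide \<open>x\<close>.\<close>
  have "x mod ?p \<in> {1..<?p}"
    using assms(2) nth_prime_pos[of r] by (auto simp: Suc_le_eq mod_greater_zero_iff_not_dvd)
  then show "(orient d (- int (x mod ?p)) 0, Div d r) \<in> succs n P (Nondiv d r)"
    by auto
  have "int x + - int (x mod ?p) = int (?p * (x div ?p))"
    by (metis add_diff_cancel_right' minus_mod_eq_mult_div of_nat_diff mod_less_eq_dividend diff_conv_add_uminus)
  then show "0 \<le> int x + - int (x mod ?p)" "reach (Div d r) (orient d (int x + - int (x mod ?p)) (0 + 0))"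
    using reach_Div[OF assms(1)] by auto
qed simp

text \<open>Player 0 makes exactly the \<open>t\<close> transfers that empty the old dimension and
  then enters \<open>Check\<close>. A doubt leads to a \<open>Drain\<close> that succeeds; otherwise
  the run continues in the other dimension. \<open>y\<close> is general because it grows with each
  transfer.\<close>

lemma reach_Mul:
  assumes "r \<in> regs P" "K \<in> conts P"
  shows "reach (Main (\<not> d) K) (orient d 0 (int (y + factor m r * t))) \<Longrightarrow>
    reach (Mul d m r K) (orient d (int (divisor m r * t)) (int y))"
proof (induction t arbitrary: y)
  case 0
  have "reach (Check d K) (orient d 0 (int y))"
    using assms 0 reach_Drain orient_nonneg[of d 0 "int y"]
    by - (rule reach_player1; auto simp: game_states_def add_zero_pair)
  then show ?case using assms
    by - (rule reach_stay[where q' = "Check d K"]; auto simp: game_states_def)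
next
  case (Suc t)
  have "reach (Mul d m r K) (orient d (int (divisor m r * t)) (int (y + factor m r)))"
    by (rule Suc.IH) (use Suc.prems in \<open>simp add: algebra_simps\<close>)
  then show ?case using assms
    by - (rule reach_move[where q' = "Mul d m r K" and u = "- int (divisor m r)" and t = "int (factor m r)"]; auto simp: game_states_def algebra_simps)
qed

text \<open>Player 0 simulates faithfully, along the halting derivation. \<open>d\<close> is
  arbitrary because every \<open>Mul\<close> swaps the dimensions.\<close>

lemma reach_Main:
  assumes "regs P \<subseteq> {..<R}"
  shows "halts K s \<Longrightarrow> K \<in> conts P \<Longrightarrow> reach (Main d K) (orient d (int (store_code R s)) 0)"
proof (induction arbitrary: d rule: halts.induct)
  case (halts_Nil s)
  have "reach (Drain (\<not> d)) (orient d (int (store_code R s)) 0)"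
    using reach_Drain[of "\<not> d"] by (simp add: orient_not)
  then show ?case using halts_Nil
    by - (rule reach_stay[where q' = "Drain (\<not> d)"]; auto simp: game_states_def)
next
  case (halts_Inc K s r)
  then have K: "K \<in> conts P" "r \<in> regs P" by (auto dest: conts_Inc regs_Inc)
  then have "r < R" using assms by auto
  have "reach (Main (\<not> d) K) (orient d 0 (int (0 + factor True r * store_code R s)))"
    using halts_Inc.IH[OF K(1), of "\<not> d"]
    unfolding store_code_Suc[OF \<open>r < R\<close>] orient_not by (simp add: factor_def)
  from reach_Mul[OF K(2,1) this]
  have "reach (Mul d True r K) (orient d (int (divisor True r * store_code R s)) (int 0))" .
  then show ?case using halts_Inc.prems
    by - (rule reach_stay[where q' = "Mul d True r K"]; auto simp: game_states_def divisor_def)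
next
  case (halts_Loop_zero s r K b)
  then have K: "K \<in> conts P" "r \<in> regs P" by (auto dest: conts_Loop regs_Loop)
  then have "r < R" using assms by auto
  have "reach (Nondiv d r) (orient d (int (store_code R s)) 0)"
    using K halts_Loop_zero.hyps dvd_store_code[OF \<open>r < R\<close>] by - (rule reach_Nondiv; auto)
  then have "reach (Zero_test d r K) (orient d (int (store_code R s)) 0)"
    using K halts_Loop_zero.IH[of d] orient_nonneg[of d "int (store_code R s)" 0]
    by - (rule reach_player1; auto simp: game_states_def add_zero_pair)
  then show ?case using halts_Loop_zero.prems
    by - (rule reach_stay[where q' = "Zero_test d r K"]; auto simp: game_states_def)
next
  case (halts_Loop_pos s r b K)
  then have K: "b @ Loop r b # K \<in> conts P" "r \<in> regs P" by (auto dest: conts_Loop regs_Loop)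
  then have "r < R" using assms by auto
  let ?s = "s(r := s r - 1)"
  have "reach (Main (\<not> d) (b @ Loop r b # K)) (orient d 0 (int (0 + factor False r * store_code R ?s)))"
    using halts_Loop_pos.IH[OF K(1), of "\<not> d"] unfolding orient_not by (simp only: factor_def if_False mult_1 add_0)
  from reach_Mul[OF K(2,1) this]
  have "reach (Mul d False r (b @ Loop r b # K)) (orient d (int (divisor False r * store_code R ?s)) (int 0))" .
  moreover have "divisor False r * store_code R ?s = store_code R s"
    using store_code_dec[OF \<open>r < R\<close>, of s] halts_Loop_pos.hyps(1) by (simp add: divisor_def)
  ultimately have "reach (Mul d False r (b @ Loop r b # K)) (orient d (int (store_code R s)) 0)"
    by (simp only: of_nat_0)
  then show ?case using halts_Loop_pos.prems
    by - (rule reach_stay[where q' = "Mul d False r (b @ Loop r b # K)"]; auto simp: game_states_def)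
qed

end

section \<open>Player 1 defeats the simulation of a diverging program\<close>

fun dir :: "st \<Rightarrow> bool" where
  "dir (Main d K) = d"
| "dir (Mul d m r K) = d"
| "dir (Check d K) = d"
| "dir (Drain d) = d"
| "dir (Zero_test d r K) = d"
| "dir (Nondiv d r) = d"
| "dir (Div d r) = d"
| "dir _ = True"

text \<open>Existence of a store with code \<open>x\<close> replaces a decoding function; registers
  from \<open>R\<close> on do not enter the code and remain arbitrary.\<close>

definition diverging :: "nat \<Rightarrow> com list \<Rightarrow> nat \<Rightarrow> bool" where
  "diverging R K x \<longleftrightarrow> (\<exists>s. x = store_code R s \<and> \<not> halts K s)"

text \<open>\<open>trap R P q x y\<close> characterises the positions lost for player 0; \<open>x\<close> is the energy in the
  dimension selected by \<open>dir q\<close> and \<open>y\<close> the energy in the other dimension.\<close>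

fun trap :: "nat \<Rightarrow> com list \<Rightarrow> st \<Rightarrow> nat \<Rightarrow> nat \<Rightarrow> bool" where
  "trap R P Init x y \<longleftrightarrow> False"
| "trap R P Start x y \<longleftrightarrow> diverging R P x \<and> y = 0"
| "trap R P Sink x y \<longleftrightarrow> 0 < x \<or> 0 < y"
| "trap R P (Main d K) x y \<longleftrightarrow> diverging R K x \<and> y = 0"
| "trap R P (Mul d m r K) x y \<longleftrightarrow> (\<forall>t. x = divisor m r * t \<longrightarrow> diverging R K (y + factor m r * t))"
| "trap R P (Check d K) x y \<longleftrightarrow> 0 < x \<or> diverging R K y"
| "trap R P (Drain d) x y \<longleftrightarrow> 0 < x"
| "trap R P (Zero_test d r K) x y \<longleftrightarrow> 0 < x \<and> y = 0 \<and> (nth_prime r dvd x \<or> diverging R K x)"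
| "trap R P (Nondiv d r) x y \<longleftrightarrow> 0 < x \<and> nth_prime r dvd x"
| "trap R P (Div d r) x y \<longleftrightarrow> \<not> nth_prime r dvd x"

definition trapped :: "nat \<Rightarrow> com list \<Rightarrow> st \<Rightarrow> int \<times> int \<Rightarrow> bool" where
  "trapped R P q z \<longleftrightarrow> (\<exists>x y. z = orient (dir q) (int x) (int y) \<and> trap R P q x y)"

lemma diverging_pos: "diverging R K x \<Longrightarrow> 0 < x"
  using store_code_pos by (auto simp: diverging_def)

lemma trap_nonzero: "trap R P q x y \<Longrightarrow> 0 < x \<or> 0 < y"
proof (induction R P q x y rule: trap.induct)
  case (5 R P d m r K x y)
  show ?case
  proof (rule ccontr)
    assume "\<not> (0 < x \<or> 0 < y)"
    \<comment> \<open>With both energies zero, no transfer is outstanding, so 0 would be the code of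
      a store; but codes are positive.\<close>
    then have "diverging R K (0 + factor m r * 0)" using 5[THEN iffD1[OF trap.simps(5)], rule_format, of 0] by simp
    then show False using diverging_pos by fastforce
  qed
qed (auto dest: diverging_pos intro: gr0I)

lemma trapped_nonzero:
  assumes "trapped R P q z"
  shows "fst z \<noteq> 0 \<or> snd z \<noteq> 0"
proof -
  from assms obtain x y where "z = orient (dir q) (int x) (int y)" "trap R P q x y"
    by (auto simp: trapped_def)
  with trap_nonzero[OF this(2)] show ?thesis by (auto simp: orient_def)
qed

lemma trappedI: "trap R P q x y \<Longrightarrow> trapped R P q (orient (dir q) (int x) (int y))"
  by (auto simp: trapped_def)

text \<open>Here and in the next two lemmas a rule of \<open>halts\<close> is read contrapositively
  and expressed on codes.\<close>

lemma diverging_Inc: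
  assumes "r < R" "diverging R (Inc r # K) x"
  shows "diverging R K (nth_prime r * x)"
proof -
  from assms(2) obtain s where "x = store_code R s" "\<not> halts K (s(r := Suc (s r)))"
    by (auto simp: diverging_def halts_Inc_iff)
  then show ?thesis
    unfolding diverging_def using store_code_Suc[OF assms(1), of s] by metis
qed

lemma diverging_Loop_zero:
  assumes "r < R" "diverging R (Loop r b # K) x"
  shows "nth_prime r dvd x \<or> diverging R K x"
  using assms dvd_store_code[OF assms(1)] by (auto simp: diverging_def halts_Loop_iff)

lemma diverging_Loop_pos:
  assumes "r < R" "diverging R (Loop r b # K) (nth_prime r * t)"
  shows "diverging R (b @ Loop r b # K) t"
proof -
  from assms(2) obtain s where s: "nth_prime r * t = store_code R s" "\<not> halts (Loop r b # K) s"
    by (auto simp: diverging_def)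
  then have pos: "0 < s r" using dvd_store_code[OF assms(1)] by (metis dvd_triv_left)
  then have "t = store_code R (s(r := s r - 1))"
    using store_code_dec[of r R s, OF assms(1) pos] s(1) nth_prime_pos[of r]
    by (metis mult_cancel1 less_irrefl)
  moreover have "\<not> halts (b @ Loop r b # K) (s(r := s r - 1))"
    using s(2) pos by (auto simp: halts_Loop_iff)
  ultimately show ?thesis unfolding diverging_def by blast
qed

text \<open>A faithful move continues a diverging run, and a false claim leads to a state where
  player 1 can challenge it. In the subgames after a justified challenge the invariant survives
  every subtraction and excludes energy zero at the exit.\<close>

lemma trapped_player0:
  assumes R: "regs P \<subseteq> {..<R}" and q: "q \<in> game_states P" "\<not> owned1 q"
    and "trapped R P q z" "(w, q') \<in> succs n P q" "0 \<le> fst (z + w)" "0 \<le> snd (z + w)"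
  shows "trapped R P q' (z + w)"
proof -
  from assms(4) obtain x y where z: "z = orient (dir q) (int x) (int y)" and t: "trap R P q x y"
    by (auto simp: trapped_def)
  show ?thesis
  proof (cases "(n, P, q)" rule: succs.cases)
    case 1
    then show ?thesis using t by simp
  next
    case (2 n' P')
    then show ?thesis using t assms(5) trappedI[of R P q' x y] z by (auto simp: add_zero_pair)
  next
    case (3 n' P')
    then show ?thesis using t assms(5) trappedI[of R P q' x y] z by (auto simp: add_zero_pair)
  next
    \<comment> \<open>The empty program halts, so this position is not trapped.\<close>
    case (4 n' P' d)
    then show ?thesis using t by (simp add: diverging_def halts_Nil)
  next
    case (5 n' P' d r K)
    then have "r < R" using q R by (auto simp: game_states_def dest!: regs_Inc)
    then show ?thesis using 5 t assms(5) diverging_Inc[of r R K x] trappedI[of R P q' x y] z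
      by (auto simp: add_zero_pair divisor_def factor_def)
  next
    case (6 n' P' d r b K)
    then have r: "r < R" using q R by (auto simp: game_states_def dest!: regs_Loop)
    have x: "diverging R (Loop r b # K) x" "y = 0" using t 6 by auto
    consider "q' = Zero_test d r K" | "q' = Mul d False r (b @ Loop r b # K)"
      using 6 assms(5) by auto
    then have "trap R P q' x y"
    proof cases
      case 1
      then show ?thesis using x diverging_pos[OF x(1)] diverging_Loop_zero[OF r x(1)] by auto
    next
      case 2
      then show ?thesis using x diverging_Loop_pos[OF r, of b K] by (auto simp: factor_def divisor_def)
    qed
    moreover have "w = (0, 0)" "dir q' = dir q" using 6 assms(5) by auto
    ultimately show ?thesis using trappedI[of R P q' x y] z by (simp add: add_zero_pair)
  next
    case (7 n' P' d m r K)
    then consider "w = orient d (- int (divisor m r)) (int (factor m r))" "q' = q"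
      | "w = (0, 0)" "q' = Check d K"
      using assms(5) by auto
    then show ?thesis
    proof cases
      case 1
      have zw: "z + w = orient d (int x - int (divisor m r)) (int (y + factor m r))"
        using 1 z 7 by (simp add: orient_add)
      have le: "divisor m r \<le> x"
        using orient_nonnegD[OF assms(6,7)[unfolded zw]] by simp
      have "trap R P q (x - divisor m r) (y + factor m r)"
      proof -
        have "diverging R K (y + factor m r + factor m r * t)" if "x - divisor m r = divisor m r * t" for t
        proof -
          \<comment> \<open>The transfer just made and the \<open>t\<close> outstanding ones
            together empty the old dimension.\<close>
          have "x = divisor m r * Suc t" using that le by simp
          moreover have "\<forall>t. x = divisor m r * t \<longrightarrow> diverging R K (y + factor m r * t)"
            using t 7 by simp
          ultimately have "diverging R K (y + factor m r * Suc t)" by blast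
          then show ?thesis by (simp add: algebra_simps)
        qed
        then show ?thesis using 7 by simp
      qed
      from trappedI[OF this] show ?thesis using 1 7 zw le by (simp add: of_nat_diff)
    next
      case 2
      \<comment> \<open>Leaving too early means \<open>0 < x\<close>, the first alternative at
        \<open>Check\<close>; for \<open>x = 0\<close> the invariant with no outstanding transfer
        gives the second.\<close>
      have "trap R P q' x y" using t[unfolded 7] 7 2 by (cases "x = 0") auto
      from trappedI[OF this] show ?thesis using 2 z 7 by (simp add: add_zero_pair)
    qed
  next
    case (9 n' P' d)
    then consider "w = orient d 0 (-1)" "q' = q" | "w = (0, 0)" "q' = Sink"
      using assms(5) by auto
    then show ?thesis
    proof cases
      case 1
      have zw: "z + w = orient d (int x) (int y - 1)"
        using 1 z 9 by (simp add: orient_add)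
      have "1 \<le> y"
        using orient_nonnegD[OF assms(6,7)[unfolded zw]] by simp
      then show ?thesis using trappedI[of R P q x "y - 1"] t 1 9 zw by (simp add: of_nat_diff)
    next
      case 2
      \<comment> \<open>\<open>dir Sink\<close> is \<open>True\<close> by default, so the two
        energies swap if \<open>d\<close> is false; the condition at \<open>Sink\<close> is
        symmetric.\<close>
      then show ?thesis using t z 9 trappedI[of R P Sink x y] trappedI[of R P Sink y x]
        by (cases d) (auto simp: orient_def add_zero_pair)
    qed
  next
    case (11 n' P' d r)
    then obtain i where i: "w = orient d (- int i) 0" "q' = Div d r" "1 \<le> i" "i < nth_prime r"
      using assms(5) by auto
    have zw: "z + w = orient d (int x - int i) (int y)"
      using i z 11 by (simp add: orient_add)
    have le: "i \<le> x"
      using orient_nonnegD[OF assms(6,7)[unfolded zw]] by simp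
    have "\<not> nth_prime r dvd x - i"
    proof
      assume "nth_prime r dvd x - i"
      moreover have "nth_prime r dvd x" using t 11 by simp
      ultimately have "nth_prime r dvd i" using le by (rule dvd_diffD1)
      then show False using i by (auto dest: dvd_imp_le)
    qed
    then show ?thesis using trappedI[of R P q' "x - i" y] i zw le by (simp add: of_nat_diff)
  next
    case (12 n' P' d r)
    then consider "w = orient d (- int (nth_prime r)) 0" "q' = q" | "w = (0, 0)" "q' = Sink"
      using assms(5) by auto
    then show ?thesis
    proof cases
      case 1
      have zw: "z + w = orient d (int x - int (nth_prime r)) (int y)"
        using 1 z 12 by (simp add: orient_add)
      have le: "nth_prime r \<le> x"
        using orient_nonnegD[OF assms(6,7)[unfolded zw]] by simp
      then have "\<not> nth_prime r dvd x - nth_prime r" using t 12 by (simp add: dvd_minus_self)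
      then show ?thesis using trappedI[of R P q "x - nth_prime r" y] 1 12 zw le by (simp add: of_nat_diff)
    next
      case 2
      have "0 < x" using t 12 by (auto intro: gr0I)
      then show ?thesis using z 12 2 trappedI[of R P Sink x y] trappedI[of R P Sink y x]
        by (cases d) (auto simp: orient_def add_zero_pair)
    qed
  qed (use q in auto)
qed

text \<open>At \<open>Check\<close> player 1 doubts iff the old dimension is not empty. At
  \<open>Zero_test\<close> a doubt is justified if the prime divides the code; otherwise accepting
  leaves a diverging continuation.\<close>

lemma trapped_player1:
  assumes "trapped R P q z" "owned1 q"
  shows "\<exists>(w, q')\<in>succs n P q. trapped R P q' (z + w)"
proof -
  from assms(1) obtain x y where z: "z = orient (dir q) (int x) (int y)" and t: "trap R P q x y"
    by (auto simp: trapped_def)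
  from assms(2) show ?thesis
  proof (cases q rule: owned1.cases)
    case (1 d K)
    show ?thesis
    proof (cases "x = 0")
      case True
      then have "trapped R P (Main (\<not> d) K) z"
        using t z 1 trappedI[of R P "Main (\<not> d) K" y x] by (simp add: orient_not)
      then show ?thesis using 1 by (auto simp: add_zero_pair)
    next
      case False
      then have "trapped R P (Drain d) z"
        using t z 1 trappedI[of R P "Drain d" x y] by simp
      then show ?thesis using 1 by (auto simp: add_zero_pair)
    qed
  next
    case (2 d r K)
    then have "trapped R P (Main d K) z \<or> trapped R P (Nondiv d r) z"
      using t z trappedI[of R P "Main d K" x y] trappedI[of R P "Nondiv d r" x y] by auto
    then show ?thesis using 2 by (auto simp: add_zero_pair)
  qed auto
qed

lemma wins0_sim_game_iff:
  assumes k: "2 \<le> k" and R: "regs P \<subseteq> {..<R}"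
  shows "wins0 (sim_game k (store_code R s) P) (to_nat Init) (AEL k (replicate k 0)) \<longleftrightarrow> halts P s"
proof
  let ?n = "store_code R s"
  let ?G = "sim_game k ?n P"
  interpret simulation k ?n P by unfold_locales (rule k)
  {
    assume "halts P s"
    then have "reach (Main True P) (int ?n, 0)"
      using reach_Main[OF R, of P s True] by (simp add: conts_self orient_def)
    then have "reach Start (int ?n, 0)"
      by - (rule reach_player0[where q' = "Main True P" and w = "(0, 0)"]; auto simp: game_states_def)
    then have "reach Init (0, 0)"
      by - (rule reach_player0[where q' = Start and w = "(int ?n, 0)"]; auto simp: game_states_def)
    moreover have "represents k (\<lambda>_. 0) (0, 0)" by (simp add: represents_def)
    ultimately obtain m where "attracts ?G k (to_nat Sink) m (to_nat Init) (\<lambda>_. 0)"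
      unfolding reach_def by blast
    moreover have "\<forall>e\<in>edges ?G. src e = to_nat Sink \<longrightarrow> tgt e = to_nat Sink \<and> (\<forall>j<k. wt e ! j = 0)"
    proof (intro ballI impI)
      fix e assume "e \<in> edges ?G" "src e = to_nat Sink"
      then obtain u v q' where "((u, v), q') \<in> succs ?n P Sink" and e: "e = mk_edge k Sink ((u, v), q')"
        by (rule edge_sim_gameE)
      then have eq: "u = 0" "v = 0" "q' = Sink" by auto
      have "represents k (\<lambda>j. 0 + wt e ! j) ((0, 0) + (u, v))"
        unfolding e by (rule represents_step[OF _ k]) (simp add: represents_def)
      from represents_iff[OF this k, of "\<lambda>x. x = 0"] show "tgt e = to_nat Sink \<and> (\<forall>j<k. wt e ! j = 0)"
        by (simp add: eq e mk_edge_simps)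
    qed
    ultimately show "wins0 ?G (to_nat Init) (AEL k (replicate k 0))"
      using wins0_if_attracts[OF weighted_game_sim_game[OF k]] by blast
  }
  {
    assume wins: "wins0 ?G (to_nat Init) (AEL k (replicate k 0))"
    show "halts P s"
    proof (rule ccontr)
      assume nh: "\<not> halts P s"
      \<comment> \<open>The invariant is carried over from \<open>st\<close> and pairs to numbered
        states and energy vectors.\<close>
      define B where "B t v \<longleftrightarrow> (\<exists>q z. t = to_nat q \<and> q \<in> game_states P \<and> represents k v z \<and> trapped R P q z)" for t v
      have "\<not> wins0 ?G (to_nat Init) (AEL k (replicate k 0))"
      proof (rule not_wins0_if_trap[where B = B])
        show "weighted_game k ?G" by (rule weighted_game_sim_game[OF k])
        show "to_nat Init \<in> states ?G" by (simp add: states_sim_game game_states_def)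
        show "\<exists>j<k. v j \<noteq> 0" if "B t v" for t v
        proof -
          from that obtain q z where "represents k v z" "trapped R P q z" by (auto simp: B_def)
          then show ?thesis using represents_iff[of k v z "\<lambda>x. x = 0"] trapped_nonzero[of R P q z] k by auto
        qed
        show "B (tgt e) (\<lambda>j. wt e ! j)" if e: "e \<in> edges ?G" "src e = to_nat Init" for e
        proof -
          from e obtain u v q' where "((u, v), q') \<in> succs ?n P Init" and e: "e = mk_edge k Init ((u, v), q')"
            by (rule edge_sim_gameE)
          then have eq: "u = int ?n" "v = 0" "q' = Start" by auto
          have "represents k (\<lambda>j. 0 + wt e ! j) ((0, 0) + (u, v))"
            unfolding e by (rule represents_step[OF _ k]) (simp add: represents_def)
          moreover have "trapped R P Start (int ?n, 0)"
            using nh trappedI[of R P Start ?n 0] by (auto simp: orient_def diverging_def)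
          ultimately show ?thesis unfolding B_def
            by (intro exI[of _ Start] exI[of _ "(int ?n, 0)"]) (auto simp: eq e mk_edge_simps game_states_def)
        qed
        show "B (tgt e) (\<lambda>j. v j + wt e ! j)"
          if B: "B t v" and t: "t \<in> states0 ?G" "e \<in> edges ?G" "src e = t"
            and nn: "\<forall>j<k. 0 \<le> v j + wt e ! j" for t v e
        proof -
          from B obtain q z where q: "t = to_nat q" "q \<in> game_states P" "represents k v z" "trapped R P q z"
            by (auto simp: B_def)
          have "\<not> owned1 q" using t q by (auto simp: sim_game_def)
          from t(2,3) q(1) obtain u w q' where e: "((u, w), q') \<in> succs ?n P q" "e = mk_edge k q ((u, w), q')"
            using edge_sim_gameE by metis
          have r: "represents k (\<lambda>j. v j + wt e ! j) (z + (u, w))"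
            unfolding e by (rule represents_step[OF q(3) k])
          have "0 \<le> fst (z + (u, w))" "0 \<le> snd (z + (u, w))"
            using nn represents_iff[OF r k, of "\<lambda>x. 0 \<le> x"] by auto
          then have "trapped R P q' (z + (u, w))"
            using trapped_player0[OF R q(2) \<open>\<not> owned1 q\<close> q(4) e(1)] by blast
          moreover have "q' \<in> game_states P" using succs_closed[OF q(2) e(1)] .
          ultimately show ?thesis unfolding B_def using r e(2) mk_edge_simps(2) by blast
        qed
        show "\<exists>e\<in>edges ?G. src e = t \<and> B (tgt e) (\<lambda>j. v j + wt e ! j)"
          if B: "B t v" and t: "t \<in> states1 ?G" for t v
        proof -
          from B obtain q z where q: "t = to_nat q" "q \<in> game_states P" "represents k v z" "trapped R P q z"
            by (auto simp: B_def)
          have "owned1 q" using t q by (auto simp: sim_game_def)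
          then obtain w q' where w: "(w, q') \<in> succs ?n P q" "trapped R P q' (z + w)"
            using trapped_player1[OF q(4)] by blast
          let ?e = "mk_edge k q (w, q')"
          have "represents k (\<lambda>j. v j + wt ?e ! j) (z + w)"
            by (rule represents_step[OF q(3) k])
          moreover have "q' \<in> game_states P" using succs_closed[OF q(2) w(1)] .
          moreover have "tgt ?e = to_nat q'" "src ?e = t" using q by (auto simp: mk_edge_def src_def tgt_def)
          ultimately have "src ?e = t \<and> B (tgt ?e) (\<lambda>j. v j + wt ?e ! j)"
            unfolding B_def using w by blast
          then show ?thesis using edge_sim_gameI[OF q(2) w(1)] by blast
        qed
      qed
      then show False using wins by blast
    qed
  }
qed

subsection \<open>Diagonalisation\<close>

definition computable :: "nat \<Rightarrow> (nat list \<Rightarrow> nat) \<Rightarrow> bool" where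
  "computable m F \<longleftrightarrow> (\<exists>f. \<forall>xs. length xs = m \<longrightarrow> recf_eval f xs = Some (F xs))"

lemma computable_nth: "i < m \<Longrightarrow> computable m (\<lambda>xs. xs ! i)"
  unfolding computable_def by (intro exI[of _ "Proj i"]) simp

lemma computable_Suc:
  assumes "computable m F"
  shows "computable m (\<lambda>xs. Suc (F xs))"
proof -
  from assms obtain f where "\<And>xs. length xs = m \<Longrightarrow> recf_eval f xs = Some (F xs)"
    unfolding computable_def by blast
  then show ?thesis
    unfolding computable_def by (intro exI[of _ "Comp Succ [f]"]) simp
qed

lemma computable_const: "computable m (\<lambda>_. c)"
proof (induction c)
  case 0
  then show ?case unfolding computable_def by (intro exI[of _ Zero]) simp
qed (rule computable_Suc)

lemma computable_comp1:
  assumes "computable 1 (\<lambda>xs. h (xs ! 0))" "computable m F"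
  shows "computable m (\<lambda>xs. h (F xs))"
proof -
  from assms obtain f g where "\<And>xs. length xs = 1 \<Longrightarrow> recf_eval g xs = Some (h (xs ! 0))"
    "\<And>xs. length xs = m \<Longrightarrow> recf_eval f xs = Some (F xs)"
    unfolding computable_def by blast
  then show ?thesis
    unfolding computable_def by (intro exI[of _ "Comp g [f]"]) simp
qed

lemma computable_comp2:
  assumes "computable 2 (\<lambda>xs. h (xs ! 0) (xs ! 1))" "computable m F" "computable m G"
  shows "computable m (\<lambda>xs. h (F xs) (G xs))"
proof -
  from assms obtain f g i where "\<And>xs. length xs = 2 \<Longrightarrow> recf_eval i xs = Some (h (xs ! 0) (xs ! 1))"
    "\<And>xs. length xs = m \<Longrightarrow> recf_eval f xs = Some (F xs)"
    "\<And>xs. length xs = m \<Longrightarrow> recf_eval g xs = Some (G xs)"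
    unfolding computable_def by blast
  then show ?thesis
    unfolding computable_def by (intro exI[of _ "Comp i [f, g]"]) simp
qed

lemma computable_rec:
  assumes "computable m B" "computable (Suc (Suc m)) S"
  shows "computable (Suc m) (\<lambda>xs. rec_nat (B (tl xs)) (\<lambda>i r. S (i # r # tl xs)) (xs ! 0))"
proof -
  from assms obtain f g where f: "\<And>xs. length xs = m \<Longrightarrow> recf_eval f xs = Some (B xs)"
    and g: "\<And>xs. length xs = Suc (Suc m) \<Longrightarrow> recf_eval g xs = Some (S xs)"
    unfolding computable_def by blast
  have "recf_eval (PrimRec f g) (n # ps) = Some (rec_nat (B ps) (\<lambda>i r. S (i # r # ps)) n)"
    if "length ps = m" for n ps
    using that by (induction n) (simp_all add: f g)
  then show ?thesis
    unfolding computable_def by (intro exI[of _ "PrimRec f g"]) (auto simp: length_Suc_conv simp del: recf_eval.simps)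
qed

lemma computable_add:
  assumes "computable m F" "computable m G"
  shows "computable m (\<lambda>xs. F xs + G xs)"
proof (rule computable_comp2[OF _ assms])
  have "rec_nat y (\<lambda>i r. Suc r) x = x + y" for x y :: nat
    by (induction x) auto
  moreover have "computable (Suc 1) (\<lambda>xs. rec_nat (tl xs ! 0) (\<lambda>i r. Suc ((i # r # tl xs) ! 1)) (xs ! 0))"
    by (rule computable_rec[of 1 "\<lambda>xs. xs ! 0" "\<lambda>xs. Suc (xs ! 1)"])
      (intro computable_Suc computable_nth; simp)+
  ultimately show "computable 2 (\<lambda>xs. xs ! 0 + xs ! 1)"
    by (simp add: computable_def numeral_2_eq_2 nth_tl)
qed

lemma computable_mult:
  assumes "computable m F" "computable m G"
  shows "computable m (\<lambda>xs. F xs * G xs)"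
proof (rule computable_comp2[OF _ assms])
  have "rec_nat 0 (\<lambda>i r. r + y) x = x * y" for x y :: nat
    by (induction x) auto
  moreover have "computable (Suc 1)
      (\<lambda>xs. rec_nat 0 (\<lambda>i r. (i # r # tl xs) ! 1 + (i # r # tl xs) ! 2) (xs ! 0))"
    by (rule computable_rec[of 1 "\<lambda>_. 0" "\<lambda>xs. xs ! 1 + xs ! 2"])
      (intro computable_const computable_add computable_nth; simp)+
  ultimately show "computable 2 (\<lambda>xs. xs ! 0 * xs ! 1)"
    by (simp add: computable_def numeral_2_eq_2 nth_tl)
qed

text \<open>A fixed base is enough: the powers to be computed have base 2 or one of three fixed
  primes.\<close>

lemma computable_power:
  assumes "computable m F"
  shows "computable m (\<lambda>xs. c ^ F xs)"
proof (rule computable_comp1[OF _ assms])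
  have "rec_nat 1 (\<lambda>i r. r * c) x = c ^ x" for x :: nat
    by (induction x) auto
  moreover have "computable (Suc 0) (\<lambda>xs. rec_nat 1 (\<lambda>i r. (i # r # tl xs) ! 1 * c) (xs ! 0))"
    by (rule computable_rec[of 0 "\<lambda>_. 1" "\<lambda>xs. xs ! 1 * c"])
      (intro computable_const computable_mult computable_nth; simp)+
  ultimately show "computable 1 (\<lambda>xs. c ^ (xs ! 0))"
    by (simp add: computable_def)
qed

lemma computable_triangle:
  assumes "computable m F"
  shows "computable m (\<lambda>xs. triangle (F xs))"
proof (rule computable_comp1[OF _ assms])
  have "rec_nat 0 (\<lambda>i r. r + Suc i) x = triangle x" for x :: nat
    by (induction x) auto
  moreover have "computable (Suc 0)
      (\<lambda>xs. rec_nat 0 (\<lambda>i r. (i # r # tl xs) ! 1 + Suc ((i # r # tl xs) ! 0)) (xs ! 0))"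
    by (rule computable_rec[of 0 "\<lambda>_. 0" "\<lambda>xs. xs ! 1 + Suc (xs ! 0)"])
      (intro computable_const computable_add computable_Suc computable_nth; simp)+
  ultimately show "computable 1 (\<lambda>xs. triangle (xs ! 0))"
    by (simp add: computable_def)
qed

lemma computable_prod_encode:
  assumes "computable m F" "computable m G"
  shows "computable m (\<lambda>xs. prod_encode (F xs, G xs))"
  unfolding prod_encode_def using assms
  by (simp add: computable_add computable_triangle)

section \<open>Games that receive their own codes as input\<close>

definition weight_code :: "nat \<Rightarrow> nat \<Rightarrow> nat" where
  "weight_code k n = list_encode (map int_encode (int n # 0 # replicate (k - 2) 0))"

lemma computable_weight_code:
  assumes "computable m F"
  shows "computable m (\<lambda>xs. weight_code k (F xs))"
proof -
  \<comment> \<open>Nonnegative integers have even codes. All other weights are constant, so only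
    the head of the vector has to be computed.\<close>
  have "int_encode (int n) = 2 * n" for n
    by (simp add: int_encode_def sum_encode_def)
  then show ?thesis
    using assms by (simp add: weight_code_def computable_Suc computable_prod_encode computable_mult computable_const)
qed

definition input_code :: "nat \<Rightarrow> nat \<Rightarrow> nat \<Rightarrow> nat" where
  "input_code a b e = nth_prime 0 ^ a * nth_prime 1 ^ b * nth_prime 2 ^ e"

text \<open>The code of the instance whose game has state sets with codes \<open>a\<close> and \<open>b\<close>, whose edges other
  than the initial one have code \<open>e\<close>, and whose initial edge puts \<open>a\<close>, \<open>b\<close>, \<open>e\<close> into the first
  three registers. Only the initial edge depends on the input, which makes this code easy to compute.\<close>

definition self_instance :: "nat \<Rightarrow> nat \<Rightarrow> nat \<Rightarrow> nat \<Rightarrow> nat" where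
  "self_instance k a b e =
     prod_encode (prod_encode (a, prod_encode (b,
         e + 2 ^ prod_encode (to_nat Init, prod_encode (weight_code k (input_code a b e), to_nat Start)))),
       prod_encode (to_nat Init, list_encode (map rat_encode (replicate k 0))))"

lemma computable_self_instance: "computable 3 (\<lambda>xs. self_instance k (xs ! 0) (xs ! 1) (xs ! 2))"
  unfolding self_instance_def input_code_def
  by (intro computable_prod_encode computable_add computable_power computable_weight_code
      computable_mult computable_const computable_nth) simp_all

text \<open>The input is mentioned only by the edge leaving \<open>Init\<close>, so the 0 in
  \<open>succs 0 P q\<close> stands for any input.\<close>

definition core_edges :: "nat \<Rightarrow> com list \<Rightarrow> nat edge set" where
  "core_edges k P = (\<Union>q\<in>game_states P - {Init}. mk_edge k q ` succs 0 P q)"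

lemma edges_sim_game:
  "edges (sim_game k n P) =
     insert (to_nat Init, int n # 0 # replicate (k - 2) 0, to_nat Start) (core_edges k P)"
proof -
  have "succs n P q = succs 0 P q" if "q \<noteq> Init" for q
    using that by (cases "(n, P, q)" rule: succs.cases) auto
  then have "(\<Union>q\<in>game_states P - {Init}. mk_edge k q ` succs n P q) = core_edges k P"
    unfolding core_edges_def by (intro SUP_cong) auto
  moreover have "Init \<in> game_states P" by (simp add: game_states_def)
  then have "edges (sim_game k n P) =
      mk_edge k Init ` succs n P Init \<union> (\<Union>q\<in>game_states P - {Init}. mk_edge k q ` succs n P q)"
    by (auto simp: sim_game_def simp del: succs.simps)
  ultimately show ?thesis
    by (simp add: mk_edge_def)
qed

text \<open>\<open>set_encode\<close> is a sum of powers of two, so the initial edge contributes one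
  summand. The state sets and the other edges do not depend on the input, so feeding their codes
  back as input is not circular.\<close>

lemma instance_encode_sim_game:
  fixes k :: nat and P :: "com list"
  defines "a \<equiv> set_encode (states0 (sim_game k 0 P))" and "b \<equiv> set_encode (states1 (sim_game k 0 P))"
    and "e \<equiv> set_encode (edge_encode ` core_edges k P)"
  shows "instance_encode (sim_game k (input_code a b e) P, to_nat Init, replicate k 0) = self_instance k a b e"
proof -
  define n where "n = input_code a b e"
  let ?i = "(to_nat Init, int n # 0 # replicate (k - 2) 0, to_nat Start) :: nat edge"
  \<comment> \<open>Core edges start outside \<open>Init\<close>; this freshness makes the power for
    the initial edge a separate summand.\<close>
  have "?i \<notin> core_edges k P"
    by (auto simp: core_edges_def mk_edge_def dest: injD[OF inj_to_nat])
  then have "edge_encode ?i \<notin> edge_encode ` core_edges k P"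
    using inj_image_mem_iff[OF inj_edge_encode] by blast
  moreover have "finite (core_edges k P)"
    by (simp add: core_edges_def finite_game_states finite_succs)
  ultimately have "set_encode (edge_encode ` edges (sim_game k n P)) = e + 2 ^ edge_encode ?i"
    by (simp add: edges_sim_game e_def del: edge_encode.simps)
  moreover have "set_encode (states0 (sim_game k n P)) = a" "set_encode (states1 (sim_game k n P)) = b"
    by (simp_all add: sim_game_def a_def b_def)
  ultimately show ?thesis
    unfolding self_instance_def weight_code_def n_def[symmetric] by (simp add: game_encode_def)
qed

text \<open>Registers from 3 on contain 0 and contribute the factor 1.\<close>

lemma store_code_input:
  assumes "3 \<le> R"
  shows "store_code R ((\<lambda>_. 0)(0 := a, 1 := b, 2 := e)) = input_code a b e"
proof -
  have "store_code R ((\<lambda>_. 0)(0 := a, 1 := b, 2 := e)) =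
      (\<Prod>r<3. nth_prime r ^ ((\<lambda>_. 0)(0 := a, 1 := b, 2 := e)) r)"
    unfolding store_code_def using assms by (intro prod.mono_neutral_right) auto
  also have "\<dots> = input_code a b e"
    by (simp add: input_code_def numeral_3_eq_3 numeral_2_eq_2)
  finally show ?thesis .
qed

section \<open>The diagonal program\<close>

theorem theorem5:
  fixes k :: nat
  assumes "2 \<le> k"
  shows "\<not> decidable instance_encode (AEL_instances k) (AEL_wins k)"
proof
  assume "decidable instance_encode (AEL_instances k) (AEL_wins k)"
  then obtain f where f: "\<And>x. x \<in> AEL_instances k \<Longrightarrow>
      recf_eval f [instance_encode x] = Some (if AEL_wins k x then 1 else 0)"
    unfolding decidable_def by blast
  obtain g where g: "\<And>xs. length xs = 3 \<Longrightarrow>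
      recf_eval g xs = Some (self_instance k (xs ! 0) (xs ! 1) (xs ! 2))"
    using computable_self_instance[of k] unfolding computable_def by blast
  \<comment> \<open>Registers 0 to 2 hold the input, 3 receives the answer, and scratch space starts
    at 4. The final loop runs forever on answer 1 and ends at once on answer 0.\<close>
  define P where "P = compile (Comp f [g]) [0, 1, 2] 3 4 @ [Loop 3 [Inc 3]]"
  \<comment> \<open>\<open>P\<close> is fixed before these codes and mentions none of them; they
    reach it only through the initial store.\<close>
  define a where "a = set_encode (states0 (sim_game k 0 P))"
  define b where "b = set_encode (states1 (sim_game k 0 P))"
  define e where "e = set_encode (edge_encode ` core_edges k P)"
  define s :: "nat \<Rightarrow> nat" where "s = (\<lambda>_. 0)(0 := a, 1 := b, 2 := e)"
  let ?x = "(sim_game k (input_code a b e) P, to_nat Init, replicate k 0 :: rat list)"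
  \<comment> \<open>At least 3, so that the code covers the three input registers.\<close>
  obtain R where R: "regs P \<subseteq> {..<R}" "3 \<le> R"
  proof -
    obtain R where "\<forall>r\<in>regs P. r < R" using finite_regs[of P] finite_nat_set_iff_bounded by auto
    then have "regs P \<subseteq> {..<max R 3}" by auto
    then show ?thesis using that by simp
  qed
  have wins: "AEL_wins k ?x \<longleftrightarrow> halts P s"
    using wins0_sim_game_iff[OF assms R(1), of s] store_code_input[OF R(2)] by (simp add: s_def)
  have "?x \<in> AEL_instances k"
    using weighted_game_sim_game[OF assms] by (simp add: AEL_instances_def states_sim_game game_states_def)
  \<comment> \<open>The decision procedure is asked about the very game that simulates
    \<open>P\<close> on \<open>s\<close>.\<close>
  from f[OF this] have "recf_eval f [self_instance k a b e] = Some (if halts P s then 1 else 0)"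
    unfolding wins instance_encode_sim_game[of k P, folded a_def b_def e_def] .
  moreover have "map s [0, 1, 2] = [a, b, e]" by (simp add: s_def)
  ultimately have "recf_eval (Comp f [g]) (map s [0, 1, 2]) = Some (if halts P s then 1 else 0)"
    by (simp add: g)
  then have "runs (compile (Comp f [g]) [0, 1, 2] 3 4) s (s(3 := if halts P s then 1 else 0))"
    by (rule runs_compile) (auto simp: s_def)
  from this[unfolded runs_def, rule_format, of "[Loop 3 [Inc 3]]"]
  have iff: "halts P s \<longleftrightarrow> halts [Loop 3 [Inc 3]] (s(3 := if halts P s then 1 else 0))"
    unfolding P_def[symmetric] .
  show False
  proof (cases "halts P s")
    case True
    then have "halts [Loop 3 [Inc 3]] (s(3 := 1))" using iff by (simp only: if_True)
    then show False using not_halts_diverge[of "s(3 := 1)" 3] by simp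
  next
    case False
    then have "\<not> halts [Loop 3 [Inc 3]] (s(3 := 0))" using iff by (simp only: if_False not_False_eq_True)
    then show False by (simp add: halts_Loop_iff halts_Nil)
  qed
qed

end
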